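(* Let $E$ be a unital Banach algebra, let $a<b$, let $\Lambda\subset[a,b]$ be a well-ordered set (in the order of $\mathbb R$) with $\min\Lambda=a$ and $\max\Lambda=b$, let $(z_\alpha)_{\alpha\in\Lambda}$ be a family in $E$, and let $A:[a,b]\to E$ be given by $A(t)=z_\alpha$ for $t\in[\alpha,S(\alpha))$, $\alpha\in\Lambda^{<b}$, and $A(b)=z_b$. Then the following conditions are equivalent: 1. $A$ is strongly McShane product integrable. 2. $A$ is Bochner integrable. 3. The family $((S(\alpha)-\alpha)z_\alpha)_{\alpha\in\Lambda^{<b}}$ is absolutely summable. 4. The family $(\exp((S(\alpha)-\alpha)\|z_\alpha\|))_{\alpha\in\Lambda^{<b}}$ of real numbers is multipliable. 5. The family $(1+(S(\alpha)-\alpha)\|z_\alpha\|)_{\alpha\in\Lambda^{<b}}$ of real numbers is multipliable.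
   Context: A unital Banach algebra is a complete normed algebra with unit $I$, $\|I\|=1$. Bochner integrability is with respect to Lebesgue measure on $[a,b]$. For a well-ordered $\Lambda\subset\mathbb R\cup\{\infty\}$: $S(\beta)$ is the smallest element of $\Lambda$ greater than $\beta$; $\Lambda^{<\gamma}=\{\alpha\in\Lambda:\alpha<\gamma\}$; an element that is neither a successor $S(\beta)$ nor the minimum is a limit element. Summability: let $\Lambda'$ be a nonempty well-ordered subset of $\mathbb R\cup\{\infty\}$, $a'=\min\Lambda'$, $b'=\sup\Lambda'$. A family $(x_\alpha)_{\alpha\in\Lambda'}$ in a normed space is summable if for every $\gamma\in\Lambda'\cup\{b'\}$ there is an element $\Sigma_{\alpha\in\Lambda'^{<\gamma}}x_\alpha$ such that: (i) $\Sigma_{\alpha\in\Lambda'^{<a'}}x_\alpha=0$, and if $\gamma=S(\beta)$, $\beta\in\Lambda'$, then $\Sigma_{\alpha\in\Lambda'^{<\gamma}}x_\alpha=x_\beta+\Sigma_{\alpha\in\Lambda'^{<\beta}}x_\alpha$; (ii) if $\gamma$ is a limit element (of $\Lambda'\cup\{b'\}$), then for each $\varepsilon>0$ there is $\beta_\varepsilon\in\Lambda'^{<\gamma}$ with $\|\Sigma_{\alpha\in\Lambda'^{<\beta}}x_\alpha-\Sigma_{\alpha\in\Lambda'^{<\gamma}}x_\alpha\|<\varepsilon$ for all $\beta\in\Lambda'\cap[\beta_\varepsilon,\gamma)$. The family is absolutely summable if $(\|x_\alpha\|)_{\alpha\in\Lambda'}$ is summable in $\mathbb R$. Multipliability of a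 family in a unital normed algebra (here $\mathbb R$) is defined in the same way with $0$ replaced by the unit, with $\Pi_{\alpha\in\Lambda'^{<\gamma}}x_\alpha=x_\beta\cdot\Pi_{\alpha\in\Lambda'^{<\beta}}x_\alpha$ for $\gamma=S(\beta)$, and with the same limit condition (ii) for the partial products (the limit is not required to be nonzero). Here these are applied with $\Lambda'=\Lambda^{<b}$. Free tagged partition of $[a,b]$: $(\xi_i,[t_{i-1},t_i])_{i=1}^m$ with $a=t_0<\dots<t_m=b$ and $\xi_i\in[a,b]$ (not necessarily in $[t_{i-1},t_i]$); for a gauge $\delta:[a,b]\to\mathbb R^+$ it is $\delta$-fine if $[t_{i-1},t_i]\subset(\xi_i-\delta(\xi_i),\xi_i+\delta(\xi_i))$ for all $i$. $A$ is strongly McShane product integrable if there is $W:[a,b]\to E$ with $W(t)$ invertible for all $t$, $W$ and $W^{-1}$ bounded, such that for every $\varepsilon>0$ there is a gauge $\delta$ with $\sum_{i=1}^m\|I+A(\xi_i)(t_i-t_{i-1})-W(t_i)W(t_{i-1})^{-1}\|<\varepsilon$ for every $\delta$-fine free tagged partition of $[a,b]$. *)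

theory Defs
  imports "HOL-Analysis.Analysis"
begin

section \<open>Well-ordered index sets\<close>

definition well_ordered_set :: "'i::linorder set \<Rightarrow> bool" where
  "well_ordered_set \<Lambda> \<longleftrightarrow> well_order_on \<Lambda> {(x, y). x \<in> \<Lambda> \<and> y \<in> \<Lambda> \<and> x \<le> y}"

definition below :: "'i::linorder set \<Rightarrow> 'i \<Rightarrow> 'i set" where
  "below \<Lambda> \<gamma> = {\<alpha> \<in> \<Lambda>. \<alpha> < \<gamma>}"

definition is_succ :: "'i::linorder set \<Rightarrow> 'i \<Rightarrow> 'i \<Rightarrow> bool" where
  "is_succ \<Lambda> \<beta> \<gamma> \<longleftrightarrow> \<gamma> \<in> \<Lambda> \<and> \<beta> < \<gamma> \<and> (\<forall>\<delta>\<in>\<Lambda>. \<beta> < \<delta> \<longrightarrow> \<gamma> \<le> \<delta>)"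

text \<open>The element $S(\beta)$; unspecified when no element of \<open>\<Lambda>\<close> exceeds \<open>\<beta>\<close>.\<close>

definition succ_in :: "'i::linorder set \<Rightarrow> 'i \<Rightarrow> 'i" where
  "succ_in \<Lambda> \<beta> = (THE \<gamma>. is_succ \<Lambda> \<beta> \<gamma>)"

definition limit_element :: "'i::linorder set \<Rightarrow> 'i \<Rightarrow> bool" where
  "limit_element \<Lambda> \<gamma> \<longleftrightarrow>
     \<gamma> \<in> \<Lambda> \<and> \<gamma> \<noteq> (LEAST \<alpha>. \<alpha> \<in> \<Lambda>) \<and> \<not> (\<exists>\<beta>\<in>\<Lambda>. is_succ \<Lambda> \<beta> \<gamma>)"


section \<open>Summability and multipliability over a well-ordered set\<close>

text \<open>
  The predicates are meant for a nonempty well-ordered \<open>\<Lambda>\<close> that is bounded above (for index type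
  \<^typ>\<open>real\<close>; the instance \<open>ereal\<close> covers sets that are unbounded or contain \<open>\<infinity>\<close>).
  The function \<open>s\<close> gives the partial sums (products): \<open>s \<gamma>\<close> is the one over \<^term>\<open>below \<Lambda> \<gamma>\<close>,
  for \<open>\<gamma>\<close> in \<^term>\<open>insert (Sup \<Lambda>) \<Lambda>\<close>. If \<open>\<Lambda>\<close> has a maximum, then \<^term>\<open>Sup \<Lambda>\<close> is that maximum
  and no partial sum contains the last term.
\<close>

definition limit_condition ::
    "'i::conditionally_complete_linorder set \<Rightarrow> ('i \<Rightarrow> 'a::real_normed_vector) \<Rightarrow> bool" where
  "limit_condition \<Lambda> s \<longleftrightarrow>
     (\<forall>\<gamma>. limit_element (insert (Sup \<Lambda>) \<Lambda>) \<gamma> \<longrightarrow>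
        (\<forall>\<epsilon>>0. \<exists>\<beta>\<^sub>\<epsilon>\<in>below \<Lambda> \<gamma>. \<forall>\<beta>\<in>\<Lambda> \<inter> {\<beta>\<^sub>\<epsilon>..<\<gamma>}. norm (s \<beta> - s \<gamma>) < \<epsilon>))"

definition wo_summable ::
    "'i::conditionally_complete_linorder set \<Rightarrow> ('i \<Rightarrow> 'a::real_normed_vector) \<Rightarrow> bool" where
  "wo_summable \<Lambda> x \<longleftrightarrow>
     (\<exists>s. s (LEAST \<alpha>. \<alpha> \<in> \<Lambda>) = 0 \<and>
          (\<forall>\<beta>\<in>\<Lambda>. \<forall>\<gamma>. is_succ (insert (Sup \<Lambda>) \<Lambda>) \<beta> \<gamma> \<longrightarrow> s \<gamma> = x \<beta> + s \<beta>) \<and>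
          limit_condition \<Lambda> s)"

definition wo_abs_summable ::
    "'i::conditionally_complete_linorder set \<Rightarrow> ('i \<Rightarrow> 'a::real_normed_vector) \<Rightarrow> bool" where
  "wo_abs_summable \<Lambda> x \<longleftrightarrow> wo_summable \<Lambda> (\<lambda>\<alpha>. norm (x \<alpha>))"

definition wo_multipliable ::
    "'i::conditionally_complete_linorder set \<Rightarrow> ('i \<Rightarrow> 'a::real_normed_algebra_1) \<Rightarrow> bool" where
  "wo_multipliable \<Lambda> x \<longleftrightarrow>
     (\<exists>s. s (LEAST \<alpha>. \<alpha> \<in> \<Lambda>) = 1 \<and>
          (\<forall>\<beta>\<in>\<Lambda>. \<forall>\<gamma>. is_succ (insert (Sup \<Lambda>) \<Lambda>) \<beta> \<gamma> \<longrightarrow> s \<gamma> = x \<beta> * s \<beta>) \<and>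
          limit_condition \<Lambda> s)"


section \<open>Bochner integrability\<close>

text \<open>
  The library's \<^const>\<open>integrable\<close> requires a second countable value space, whereas here the values
  lie in an arbitrary Banach space. Almost everywhere convergence of the simple functions expresses
  strong measurability; for complete \<open>M\<close>, such as \<open>lebesgue_on {a..b}\<close>, it makes the integrands
  \<open>norm (f x - s n x)\<close> measurable.
\<close>

definition bochner_integrable :: "'m measure \<Rightarrow> ('m \<Rightarrow> 'a::real_normed_vector) \<Rightarrow> bool" where
  "bochner_integrable M f \<longleftrightarrow>
     (\<exists>s. (\<forall>n. Bochner_Integration.simple_bochner_integrable M (s n)) \<and>
          (AE x in M. (\<lambda>n. s n x) \<longlonglongrightarrow> f x) \<and>
          (\<lambda>n. \<integral>\<^sup>+x. ennreal (norm (f x - s n x)) \<partial>M) \<longlonglongrightarrow> 0)"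


section \<open>Strong McShane product integrability\<close>

definition alg_invertible :: "'a::monoid_mult \<Rightarrow> bool" where
  "alg_invertible x \<longleftrightarrow> (\<exists>y. x * y = 1 \<and> y * x = 1)"

definition alg_inverse :: "'a::monoid_mult \<Rightarrow> 'a" where
  "alg_inverse x = (THE y. x * y = 1 \<and> y * x = 1)"

text \<open>The tags \<open>\<xi> i\<close> need not lie in the corresponding intervals.\<close>

definition free_tagged_partition ::
    "real \<Rightarrow> real \<Rightarrow> nat \<Rightarrow> (nat \<Rightarrow> real) \<Rightarrow> (nat \<Rightarrow> real) \<Rightarrow> bool" where
  "free_tagged_partition a b m t \<xi> \<longleftrightarrow>
     t 0 = a \<and> t m = b \<and> (\<forall>i\<in>{1..m}. t (i - 1) < t i \<and> \<xi> i \<in> {a..b})"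

definition delta_fine ::
    "(real \<Rightarrow> real) \<Rightarrow> nat \<Rightarrow> (nat \<Rightarrow> real) \<Rightarrow> (nat \<Rightarrow> real) \<Rightarrow> bool" where
  "delta_fine \<delta> m t \<xi> \<longleftrightarrow>
     (\<forall>i\<in>{1..m}. {t (i - 1)..t i} \<subseteq> {\<xi> i - \<delta> (\<xi> i)<..<\<xi> i + \<delta> (\<xi> i)})"

definition strongly_McShane_product_integrable ::
    "real \<Rightarrow> real \<Rightarrow> (real \<Rightarrow> 'a::real_normed_algebra_1) \<Rightarrow> bool" where
  "strongly_McShane_product_integrable a b A \<longleftrightarrow>
     (\<exists>W. (\<forall>t\<in>{a..b}. alg_invertible (W t)) \<and>
          bounded (W ` {a..b}) \<and> bounded ((\<lambda>t. alg_inverse (W t)) ` {a..b}) \<and>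
          (\<forall>\<epsilon>>0. \<exists>\<delta>. (\<forall>x\<in>{a..b}. 0 < \<delta> x) \<and>
             (\<forall>m t \<xi>. free_tagged_partition a b m t \<xi> \<and> delta_fine \<delta> m t \<xi> \<longrightarrow>
                (\<Sum>i=1..m. norm (1 + (t i - t (i - 1)) *\<^sub>R A (\<xi> i)
                                  - W (t i) * alg_inverse (W (t (i - 1))))) < \<epsilon>)))"


section \<open>Step functions with well-ordered steps\<close>

text \<open>
  The last condition is void when the intervals $[\alpha, S(\alpha))$ cover $[a,b)$. They fail to do
  so if \<open>\<Lambda>\<close> omits the supremum of one of its nonempty subsets (e.g. $\{1 - 1/n\} \cup \{2\}$); the
  prescription then leaves the function undetermined on gaps, where it is taken to be \<open>0\<close>.
\<close>

definition is_step_function ::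
    "real set \<Rightarrow> real \<Rightarrow> real \<Rightarrow> (real \<Rightarrow> 'a::zero) \<Rightarrow> (real \<Rightarrow> 'a) \<Rightarrow> bool" where
  "is_step_function \<Lambda> a b z A \<longleftrightarrow>
     (\<forall>\<alpha>\<in>below \<Lambda> b. \<forall>t\<in>{\<alpha>..<succ_in \<Lambda> \<alpha>}. A t = z \<alpha>) \<and>
     A b = z b \<and>
     (\<forall>t\<in>{a..<b} - (\<Union>\<alpha>\<in>below \<Lambda> b. {\<alpha>..<succ_in \<Lambda> \<alpha>}). A t = 0)"

end

theory Submission
  imports Defs
begin

text \<open>
  All five conditions say that $\sum_\alpha (S(\alpha)-\alpha)\|z_\alpha\| < \infty$, as an unordered sum of
  nonnegative reals. For the families over \<open>\<Lambda>\<close> this is transfinite induction, with logarithms turning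
  products into sums; for Bochner integrability the sum is $\int\|A\|$.

  If the sum is finite, switching on the steps one by one gives solutions $W_n$ of $W_n' = A_n W_n$
  whose propagators satisfy
  $\|P_{n+1}(u,v)-P_n(u,v)\| \le e^{F_{n+1}(v)-F_{n+1}(u)}-e^{F_n(v)-F_n(u)}$ with
  $F_n(t)=\int_a^t\|A_n\|$, so that they converge by telescoping. A tag in the interior of a step
  contributes the linearization error of one exponential; the countably many remaining tags
  contribute little when the gauge is small there. Conversely, comparing two choices of free tags
  bounds the Riemann sums of $\|A\|$.
\<close>


section \<open>Families indexed by well-ordered sets\<close>

text \<open>Steps may accumulate at many points, so a product taken along \<Lambda> would itself
  need transfinite limits. The steps are therefore switched on in the order of an enumeration by
  natural numbers, unrelated to their order on the line, and each stage inserts one exponential at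
  its place. Factors need not commute, so the new factor sits between two old propagators. This is
  why all estimates concern P_n(u,v) for arbitrary u and v and not W_n alone; the same insertion in
  the scalar equation gives the majorant. In the gauge, an interval whose tag is an endpoint of
  steps may cross infinitely many steps. There only crude bounds are available: the size of A at the
  tag and the continuity of the limit of F_n. These tags are countably many, so weights 2^(-k) can
  be assigned to them. Tags inside a step are uncountably many, but their intervals stay in that
  step and have errors proportional to their length. In the converse A is not yet known to be
  integrable, so its truncations to finitely many steps are integrated, with bounds that do not
  depend on their number.\<close>

lemma well_ordered_set_least:
  assumes "well_ordered_set \<Lambda>" "X \<subseteq> \<Lambda>" "X \<noteq> {}"
  obtains m where "m \<in> X" "\<And>y. y \<in> X \<Longrightarrow> m \<le> y"
proof -
  have "wf ({(x, y). x \<in> \<Lambda> \<and> y \<in> \<Lambda> \<and> x \<le> y} - Id)"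
    using assms(1) by (simp add: well_ordered_set_def well_order_on_def)
  then obtain m where m: "m \<in> X"
      "\<And>y. (y, m) \<in> {(x, y). x \<in> \<Lambda> \<and> y \<in> \<Lambda> \<and> x \<le> y} - Id \<Longrightarrow> y \<notin> X"
    using wfE_min'[OF _ assms(3)] by blast
  have "m \<le> y" if "y \<in> X" for y
    using m(2)[of y] that assms(2) m(1) linear[of y m] by fastforce
  with m(1) that show thesis by blast
qed

locale wo_index =
  fixes \<Lambda> :: "'i::conditionally_complete_linorder set"
  assumes least_ex: "X \<subseteq> \<Lambda> \<Longrightarrow> X \<noteq> {} \<Longrightarrow> \<exists>m\<in>X. \<forall>y\<in>X. m \<le> y"
    and nonempty: "\<Lambda> \<noteq> {}"
    and bdd: "bdd_above \<Lambda>"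
begin

text \<open>Partial sums live on \<open>ext\<close>: a family without last index still needs a value
  at its supremum, and if \<Lambda> has a maximum, \<open>ext\<close> is \<Lambda> itself.\<close>

definition ext :: "'i set" where "ext = insert (Sup \<Lambda>) \<Lambda>"

definition bottom :: 'i where "bottom = (LEAST \<alpha>. \<alpha> \<in> \<Lambda>)"

lemma bottom: "bottom \<in> \<Lambda>" "\<And>y. y \<in> \<Lambda> \<Longrightarrow> bottom \<le> y"
proof -
  obtain m where m: "m \<in> \<Lambda>" "\<forall>y\<in>\<Lambda>. m \<le> y" using least_ex[of \<Lambda>] nonempty by auto
  have "bottom = m" unfolding bottom_def by (rule Least_equality) (use m in auto)
  then show "bottom \<in> \<Lambda>" "\<And>y. y \<in> \<Lambda> \<Longrightarrow> bottom \<le> y" using m by auto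
qed

lemma le_Sup: "y \<in> ext \<Longrightarrow> y \<le> Sup \<Lambda>"
  by (auto simp: ext_def intro: cSup_upper bdd)

lemma ext_less_imp: "\<beta> \<in> ext \<Longrightarrow> \<gamma> \<in> ext \<Longrightarrow> \<beta> < \<gamma> \<Longrightarrow> \<beta> \<in> \<Lambda>"
  using le_Sup[of \<gamma>] by (auto simp: ext_def)

lemma bottom_le_ext: "y \<in> ext \<Longrightarrow> bottom \<le> y"
  using bottom le_Sup[of bottom] by (auto simp: ext_def)

lemma Least_ext: "(LEAST \<alpha>. \<alpha> \<in> ext) = bottom"
  by (rule Least_equality) (use bottom bottom_le_ext in \<open>auto simp: ext_def\<close>)

text \<open>A least counterexample exists in \<open>ext\<close> too, since the only element that
  \<open>ext\<close> may add to \<Lambda> lies above all others; it is the bottom, a successor or a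
  limit.\<close>

lemma ext_induct [consumes 1, case_names bottom succ limit]:
  assumes "\<gamma> \<in> ext"
    and bot: "P bottom"
    and succ: "\<And>\<beta> \<gamma>. \<beta> \<in> \<Lambda> \<Longrightarrow> is_succ ext \<beta> \<gamma> \<Longrightarrow> P \<beta> \<Longrightarrow> P \<gamma>"
    and lim: "\<And>\<gamma>. limit_element ext \<gamma> \<Longrightarrow> (\<And>\<beta>. \<beta> \<in> below \<Lambda> \<gamma> \<Longrightarrow> P \<beta>) \<Longrightarrow> P \<gamma>"
  shows "P \<gamma>"
proof (rule ccontr)
  define X where "X = {\<gamma> \<in> ext. \<not> P \<gamma>}"
  assume "\<not> P \<gamma>"
  then have ne: "X \<noteq> {}" using assms(1) by (auto simp: X_def)
  have "\<exists>m\<in>X. \<forall>y\<in>X. m \<le> y"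
  proof (cases "X \<inter> \<Lambda> = {}")
    case True
    then have "X = {Sup \<Lambda>}" using ne by (auto simp: X_def ext_def)
    then show ?thesis by simp
  next
    case False
    then obtain m where m: "m \<in> X \<inter> \<Lambda>" "\<forall>y\<in>X \<inter> \<Lambda>. m \<le> y" using least_ex[of "X \<inter> \<Lambda>"] by auto
    have "m \<le> y" if "y \<in> X" for y
      using that m le_Sup[of m] by (cases "y \<in> \<Lambda>") (auto simp: X_def ext_def)
    with m(1) show ?thesis by auto
  qed
  then obtain m where m: "m \<in> ext" "\<not> P m" "\<And>y. y \<in> ext \<Longrightarrow> \<not> P y \<Longrightarrow> m \<le> y"
    by (auto simp: X_def)
  have small: "P \<beta>" if "\<beta> \<in> ext" "\<beta> < m" for \<beta> using m(3)[of \<beta>] that by force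
  consider "m = bottom" | \<beta> where "\<beta> \<in> ext" "is_succ ext \<beta> m" | "limit_element ext m"
    using m(1) Least_ext unfolding limit_element_def by auto
  then show False
  proof cases
    case 1
    then show False using bot m(2) by simp
  next
    case 2
    then have "\<beta> < m" by (simp add: is_succ_def)
    with 2 small ext_less_imp m show False using succ by blast
  next
    case 3
    then show False using lim[of m] small m(2) by (auto simp: below_def ext_def)
  qed
qed

text \<open>Between the largest element of \<open>F\<close> and \<gamma> lies a further element, for
  otherwise \<gamma> would be its successor. Finite subsums below a limit element are thus contained
  in an earlier partial sum.\<close>

lemma limit_not_below_bounded:
  assumes "limit_element ext \<gamma>" "finite F" "F \<subseteq> below \<Lambda> \<gamma>"
  shows "\<exists>\<beta>0\<in>below \<Lambda> \<gamma>. \<forall>\<alpha>\<in>F. \<alpha> < \<beta>0"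
proof -
  have g: "\<gamma> \<in> ext" "\<gamma> \<noteq> bottom" "\<And>\<beta>. \<beta> \<in> ext \<Longrightarrow> \<not> is_succ ext \<beta> \<gamma>"
    using assms(1) Least_ext by (auto simp: limit_element_def)
  \<comment> \<open>\<open>bottom\<close> is inserted so that the maximum also exists for empty
    \<open>F\<close>.\<close>
  define M where "M = Max (insert bottom F)"
  have b: "bottom \<in> below \<Lambda> \<gamma>"
    using bottom bottom_le_ext[OF g(1)] g(2) by (auto simp: below_def)
  have "M \<in> insert bottom F" unfolding M_def by (rule Max_in) (use assms in auto)
  then have M: "M \<in> below \<Lambda> \<gamma>" using b assms by auto
  then have "\<not> is_succ ext M \<gamma>" using g by (auto simp: below_def ext_def)
  then obtain \<delta> where d: "\<delta> \<in> ext" "M < \<delta>" "\<delta> < \<gamma>"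
    using M g by (auto simp: is_succ_def below_def not_le)
  then have "\<delta> \<in> below \<Lambda> \<gamma>" using ext_less_imp g(1) by (auto simp: below_def)
  moreover have "\<alpha> < \<delta>" if "\<alpha> \<in> F" for \<alpha>
  proof -
    have "\<alpha> \<le> M" unfolding M_def by (rule Max_ge) (use assms that in auto)
    then show ?thesis using d by simp
  qed
  ultimately show ?thesis by auto
qed

lemma below_succ:
  assumes "\<beta> \<in> \<Lambda>" "is_succ ext \<beta> \<gamma>"
  shows "below \<Lambda> \<gamma> = insert \<beta> (below \<Lambda> \<beta>)" "\<beta> \<notin> below \<Lambda> \<beta>"
proof -
  have "\<gamma> \<le> \<delta>" if "\<delta> \<in> \<Lambda>" "\<beta> < \<delta>" for \<delta> using assms(2) that by (auto simp: is_succ_def ext_def)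
  then show "below \<Lambda> \<gamma> = insert \<beta> (below \<Lambda> \<beta>)"
    using assms by (fastforce simp: is_succ_def below_def)
qed (simp add: below_def)

lemma below_bottom [simp]: "below \<Lambda> bottom = {}"
  using bottom by (force simp: below_def)

text \<open>The index sets differ by at most the maximum of \<Lambda>. Induction up to
  \<open>Sup \<Lambda>\<close> reaches only the left side, because a last term enters no partial
  sum.\<close>

lemma summable_on_below_Sup: "x summable_on below \<Lambda> (Sup \<Lambda>) \<longleftrightarrow> x summable_on \<Lambda>" for x :: "'i \<Rightarrow> real"
proof -
  have "\<Lambda> = below \<Lambda> (Sup \<Lambda>) \<or> \<Lambda> = insert (Sup \<Lambda>) (below \<Lambda> (Sup \<Lambda>))"
  proof (cases "Sup \<Lambda> \<in> \<Lambda>")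
    case True
    have "\<Lambda> = insert (Sup \<Lambda>) (below \<Lambda> (Sup \<Lambda>))"
      using le_Sup True unfolding below_def ext_def by (auto simp: less_le)
    then show ?thesis by blast
  next
    case False
    then show ?thesis using le_Sup unfolding below_def ext_def by (auto simp: less_le)
  qed
  then show ?thesis by (metis summable_on_insert_iff)
qed

section \<open>Transfinite partial sums and products compared with unordered sums\<close>

lemma wo_summable_iff:
  "wo_summable \<Lambda> x \<longleftrightarrow>
    (\<exists>s. s bottom = 0 \<and> (\<forall>\<beta>\<in>\<Lambda>. \<forall>\<gamma>. is_succ ext \<beta> \<gamma> \<longrightarrow> s \<gamma> = x \<beta> + s \<beta>) \<and> limit_condition \<Lambda> s)"
  by (simp add: wo_summable_def ext_def bottom_def)

lemma wo_multipliable_iff: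
  "wo_multipliable \<Lambda> x \<longleftrightarrow>
    (\<exists>s. s bottom = 1 \<and> (\<forall>\<beta>\<in>\<Lambda>. \<forall>\<gamma>. is_succ ext \<beta> \<gamma> \<longrightarrow> s \<gamma> = x \<beta> * s \<beta>) \<and> limit_condition \<Lambda> s)"
  by (simp add: wo_multipliable_def ext_def bottom_def)

lemma limit_conditionD:
  assumes "limit_condition \<Lambda> s" "limit_element ext \<gamma>" "\<epsilon> > 0"
  obtains \<beta>0 where "\<beta>0 \<in> below \<Lambda> \<gamma>"
    "\<And>\<beta>. \<beta> \<in> \<Lambda> \<Longrightarrow> \<beta>0 \<le> \<beta> \<Longrightarrow> \<beta> < \<gamma> \<Longrightarrow> norm (s \<beta> - s \<gamma>) < \<epsilon>"
  using assms unfolding limit_condition_def ext_def by (metis IntI atLeastLessThan_iff)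

lemma limit_conditionI:
  assumes "\<And>\<gamma> \<epsilon>. limit_element ext \<gamma> \<Longrightarrow> \<epsilon> > 0 \<Longrightarrow>
    \<exists>\<beta>0\<in>below \<Lambda> \<gamma>. \<forall>\<beta>. \<beta> \<in> \<Lambda> \<and> \<beta>0 \<le> \<beta> \<and> \<beta> < \<gamma> \<longrightarrow> norm (s \<beta> - s \<gamma>) < \<epsilon>"
  shows "limit_condition \<Lambda> s"
  using assms unfolding limit_condition_def ext_def by (metis IntE atLeastLessThan_iff)

text \<open>Applied with \<open>exp\<close> and \<open>ln\<close>, this turns partial sums into
  partial products and back. Continuity is asked only at the values at limit elements, since
  \<open>ln\<close> needs positive arguments.\<close>

lemma limit_condition_compose:
  assumes "limit_condition \<Lambda> s" "\<And>\<gamma>. limit_element ext \<gamma> \<Longrightarrow> isCont f (s \<gamma>)"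
  shows "limit_condition \<Lambda> (\<lambda>\<gamma>. f (s \<gamma>))"
proof (rule limit_conditionI)
  fix \<gamma> and \<epsilon> :: real assume g: "limit_element ext \<gamma>" and "\<epsilon> > 0"
  then obtain d where d: "d > 0" "\<And>y. dist y (s \<gamma>) < d \<Longrightarrow> dist (f y) (f (s \<gamma>)) < \<epsilon>"
    using assms(2)[OF g] unfolding continuous_at_eps_delta by blast
  obtain \<beta>0 where "\<beta>0 \<in> below \<Lambda> \<gamma>"
    "\<And>\<beta>. \<beta> \<in> \<Lambda> \<Longrightarrow> \<beta>0 \<le> \<beta> \<Longrightarrow> \<beta> < \<gamma> \<Longrightarrow> norm (s \<beta> - s \<gamma>) < d"
    using limit_conditionD[OF assms(1) g d(1)] by blast
  then show "\<exists>\<beta>0\<in>below \<Lambda> \<gamma>. \<forall>\<beta>. \<beta> \<in> \<Lambda> \<and> \<beta>0 \<le> \<beta> \<and> \<beta> < \<gamma> \<longrightarrow> norm (f (s \<beta>) - f (s \<gamma>)) < \<epsilon>"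
    using d(2) by (auto simp: dist_norm)
qed

text \<open>For nonnegative terms the partial sum at \<gamma> must be the supremum of the finite
  sums below \<gamma>. Finite sums are caught by earlier partial sums, which gives the limit
  condition in one direction and, by induction over \<open>ext\<close>, the values of
  \<open>s\<close> in the other.\<close>

lemma wo_summable_iff_summable_on:
  fixes x :: "'i \<Rightarrow> real"
  assumes nonneg: "\<And>\<alpha>. \<alpha> \<in> \<Lambda> \<Longrightarrow> 0 \<le> x \<alpha>"
  shows "wo_summable \<Lambda> x \<longleftrightarrow> x summable_on \<Lambda>"
proof
  assume sm: "x summable_on \<Lambda>"
  have sub: "x summable_on below \<Lambda> \<gamma>" for \<gamma>
    using summable_on_subset_banach[OF sm] by (auto simp: below_def)
  define s where "s \<gamma> = infsum x (below \<Lambda> \<gamma>)" for \<gamma>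
  have mono: "s \<beta> \<le> s \<gamma>" if "\<beta> \<le> \<gamma>" for \<beta> \<gamma>
    unfolding s_def using sub that nonneg by (intro infsum_mono2) (auto simp: below_def)
  have "limit_condition \<Lambda> s"
  proof (rule limit_conditionI)
    fix \<gamma> and \<epsilon> :: real assume g: "limit_element ext \<gamma>" and e: "\<epsilon> > 0"
    obtain F where F: "finite F" "F \<subseteq> below \<Lambda> \<gamma>" "dist (sum x F) (s \<gamma>) \<le> \<epsilon> / 2"
      using infsum_finite_approximation[OF sub, of "\<epsilon>/2" \<gamma>] e by (auto simp: s_def)
    obtain \<beta>0 where b: "\<beta>0 \<in> below \<Lambda> \<gamma>" "\<forall>\<alpha>\<in>F. \<alpha> < \<beta>0"
      using limit_not_below_bounded[OF g F(1,2)] by blast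
    have "norm (s \<beta> - s \<gamma>) < \<epsilon>" if "\<beta>0 \<le> \<beta>" "\<beta> < \<gamma>" for \<beta>
    proof -
      have "sum x F \<le> s \<beta>"
        unfolding s_def using F b that nonneg
        by (intro finite_sum_le_infsum sub) (fastforce simp: below_def)+
      moreover have "s \<beta> \<le> s \<gamma>" using mono that by simp
      ultimately show ?thesis using F(3) e unfolding dist_real_def real_norm_def by linarith
    qed
    then show "\<exists>\<beta>0\<in>below \<Lambda> \<gamma>. \<forall>\<beta>. \<beta> \<in> \<Lambda> \<and> \<beta>0 \<le> \<beta> \<and> \<beta> < \<gamma> \<longrightarrow> norm (s \<beta> - s \<gamma>) < \<epsilon>"
      using b(1) by auto
  qed
  moreover have "s \<gamma> = x \<beta> + s \<beta>" if "\<beta> \<in> \<Lambda>" "is_succ ext \<beta> \<gamma>" for \<beta> \<gamma>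
    unfolding s_def below_succ(1)[OF that] by (rule infsum_insert[OF sub below_succ(2)[OF that]])
  ultimately show "wo_summable \<Lambda> x"
    unfolding wo_summable_iff by (intro exI[of _ s]) (auto simp: s_def)
next
  assume "wo_summable \<Lambda> x"
  then obtain s where s: "s bottom = 0" "limit_condition \<Lambda> s"
    "\<And>\<beta> \<gamma>. \<beta> \<in> \<Lambda> \<Longrightarrow> is_succ ext \<beta> \<gamma> \<Longrightarrow> s \<gamma> = x \<beta> + s \<beta>"
    unfolding wo_summable_iff by blast
  have "x summable_on below \<Lambda> \<gamma> \<and> infsum x (below \<Lambda> \<gamma>) = s \<gamma>" if "\<gamma> \<in> ext" for \<gamma>
    using that
  proof (induction rule: ext_induct)
    case bottom
    then show ?case using s(1) by simp
  next
    case (succ \<beta> \<gamma>)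
    then show ?case
      using below_succ[OF succ(1,2)] infsum_insert[of x "below \<Lambda> \<beta>" \<beta>] s(3)[OF succ(1,2)]
      by (simp add: summable_on_insert_iff)
  next
    case (limit \<gamma>)
    have up: "sum x F \<le> s \<gamma> + \<epsilon>" if F: "finite F" "F \<subseteq> below \<Lambda> \<gamma>" and e: "\<epsilon> > 0" for F \<epsilon>
    proof -
      obtain \<beta>0 where b0: "\<beta>0 \<in> below \<Lambda> \<gamma>" "\<forall>\<alpha>\<in>F. \<alpha> < \<beta>0"
        using limit_not_below_bounded[OF limit(1) F(1,2)] by blast
      obtain \<beta>1 where b1: "\<beta>1 \<in> below \<Lambda> \<gamma>"
        "\<And>\<beta>. \<beta> \<in> \<Lambda> \<Longrightarrow> \<beta>1 \<le> \<beta> \<Longrightarrow> \<beta> < \<gamma> \<Longrightarrow> norm (s \<beta> - s \<gamma>) < \<epsilon>"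
        using limit_conditionD[OF s(2) limit(1) e] by blast
      \<comment> \<open>From \<open>\<beta>0\<close> on, the partial sum contains \<open>F\<close>;
        from \<open>\<beta>1\<close> on, it is within \<epsilon> of the limit value.\<close>
      define \<beta> where "\<beta> = max \<beta>0 \<beta>1"
      have b: "\<beta> \<in> below \<Lambda> \<gamma>" "\<beta>0 \<le> \<beta>" "\<beta>1 \<le> \<beta>"
        using b0 b1 by (auto simp: \<beta>_def below_def max_def)
      have "sum x F \<le> infsum x (below \<Lambda> \<beta>)"
      proof (rule finite_sum_le_infsum)
        show "x summable_on below \<Lambda> \<beta>" using limit(2)[OF b(1)] by simp
        have "\<alpha> < \<beta>" if "\<alpha> \<in> F" for \<alpha> using b0(2) b(2) that less_le_trans by blast
        then show "F \<subseteq> below \<Lambda> \<beta>" using F(2) by (auto simp: below_def)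
      qed (use F nonneg in \<open>auto simp: below_def\<close>)
      also have "\<dots> = s \<beta>" using limit(2)[OF b(1)] by simp
      also have "\<dots> \<le> s \<gamma> + \<epsilon>" using b1(2)[of \<beta>] b by (auto simp: below_def)
      finally show ?thesis .
    qed
    have le: "sum x F \<le> s \<gamma>" if "finite F" "F \<subseteq> below \<Lambda> \<gamma>" for F
      by (rule field_le_epsilon) (use up that in blast)
    have sm: "x summable_on below \<Lambda> \<gamma>"
      using nonneg le by (intro nonneg_bdd_above_summable_on bdd_aboveI2[where M = "s \<gamma>"])
        (auto simp: below_def)
    have "s \<gamma> \<le> infsum x (below \<Lambda> \<gamma>)"
    proof (rule field_le_epsilon)
      fix \<epsilon> :: real assume e: "\<epsilon> > 0"
      obtain \<beta>1 where b1: "\<beta>1 \<in> below \<Lambda> \<gamma>" "norm (s \<beta>1 - s \<gamma>) < \<epsilon>"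
        using limit_conditionD[OF s(2) limit(1) e] by (metis below_def mem_Collect_eq order_refl)
      have "infsum x (below \<Lambda> \<beta>1) \<le> infsum x (below \<Lambda> \<gamma>)"
        using limit(2)[OF b1(1)] sm b1(1) nonneg by (intro infsum_mono2) (auto simp: below_def)
      then show "s \<gamma> \<le> infsum x (below \<Lambda> \<gamma>) + \<epsilon>" using b1(2) limit(2)[OF b1(1)] by auto
    qed
    moreover have "infsum x (below \<Lambda> \<gamma>) \<le> s \<gamma>"
      using le by (intro infsum_le_finite_sums sm)
    ultimately show ?case using sm by auto
  qed
  then have "x summable_on below \<Lambda> (Sup \<Lambda>)" by (simp add: ext_def)
  then show "x summable_on \<Lambda>" by (simp add: summable_on_below_Sup)
qed

text \<open>Logarithms of partial products are partial sums. As all factors are at least 1,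
  induction keeps the partial products at least 1, so a limit 0, where \<open>ln\<close> would fail,
  cannot occur.\<close>

lemma wo_multipliable_exp_iff:
  fixes x :: "'i \<Rightarrow> real"
  assumes nonneg: "\<And>\<alpha>. \<alpha> \<in> \<Lambda> \<Longrightarrow> 0 \<le> x \<alpha>" and y: "\<And>\<alpha>. \<alpha> \<in> \<Lambda> \<Longrightarrow> y \<alpha> = exp (x \<alpha>)"
  shows "wo_multipliable \<Lambda> y \<longleftrightarrow> wo_summable \<Lambda> x"
proof
  assume "wo_summable \<Lambda> x"
  then obtain s where s: "s bottom = 0" "limit_condition \<Lambda> s"
    "\<And>\<beta> \<gamma>. \<beta> \<in> \<Lambda> \<Longrightarrow> is_succ ext \<beta> \<gamma> \<Longrightarrow> s \<gamma> = x \<beta> + s \<beta>"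
    unfolding wo_summable_iff by blast
  have "limit_condition \<Lambda> (\<lambda>\<gamma>. exp (s \<gamma>))"
    by (rule limit_condition_compose[OF s(2)]) simp
  then show "wo_multipliable \<Lambda> y"
    unfolding wo_multipliable_iff using s y
    by (intro exI[of _ "\<lambda>\<gamma>. exp (s \<gamma>)"]) (auto simp: exp_add)
next
  assume "wo_multipliable \<Lambda> y"
  then obtain s where s: "s bottom = 1" "limit_condition \<Lambda> s"
    "\<And>\<beta> \<gamma>. \<beta> \<in> \<Lambda> \<Longrightarrow> is_succ ext \<beta> \<gamma> \<Longrightarrow> s \<gamma> = y \<beta> * s \<beta>"
    unfolding wo_multipliable_iff by blast
  have ge1: "1 \<le> s \<gamma>" if "\<gamma> \<in> ext" for \<gamma>
    using that
  proof (induction rule: ext_induct)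
    case bottom
    then show ?case using s(1) by simp
  next
    case (succ \<beta> \<gamma>)
    have "1 * 1 \<le> exp (x \<beta>) * s \<beta>"
      using succ nonneg by (intro mult_mono) auto
    then show ?case using s(3)[OF succ(1,2)] y[OF succ(1)] by simp
  next
    case (limit \<gamma>)
    show ?case
    proof (rule field_le_epsilon)
      fix \<epsilon> :: real assume e: "\<epsilon> > 0"
      obtain \<beta>1 where b1: "\<beta>1 \<in> below \<Lambda> \<gamma>" "norm (s \<beta>1 - s \<gamma>) < \<epsilon>"
        using limit_conditionD[OF s(2) limit(1) e] by (metis below_def mem_Collect_eq order_refl)
      then show "1 \<le> s \<gamma> + \<epsilon>" using limit(2)[OF b1(1)] by auto
    qed
  qed
  have "limit_condition \<Lambda> (\<lambda>\<gamma>. ln (s \<gamma>))"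
    using ge1 by (intro limit_condition_compose[OF s(2)] isCont_ln) (force simp: limit_element_def)
  moreover have "ln (s \<gamma>) = x \<beta> + ln (s \<beta>)" if "\<beta> \<in> \<Lambda>" "is_succ ext \<beta> \<gamma>" for \<beta> \<gamma>
    using s(3)[OF that] y[OF that(1)] ge1[of \<beta>] that(1) by (auto simp: ext_def ln_mult)
  ultimately show "wo_summable \<Lambda> x"
    unfolding wo_summable_iff using s(1) by (intro exI[of _ "\<lambda>\<gamma>. ln (s \<gamma>)"]) auto
qed

text \<open>One direction is \<open>ln (1 + x) \<le> x\<close>. Conversely every single logarithm is
  at most the total sum, so \<open>1 + x \<alpha>\<close> is at most its exponential
  \<open>M\<close>, and \<open>x \<le> (1 + x) * ln (1 + x)\<close> yields the majorant.\<close>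

lemma summable_on_ln_one_plus_iff:
  fixes x :: "'i \<Rightarrow> real"
  assumes nonneg: "\<And>\<alpha>. \<alpha> \<in> \<Lambda> \<Longrightarrow> 0 \<le> x \<alpha>"
  shows "(\<lambda>\<alpha>. ln (1 + x \<alpha>)) summable_on \<Lambda> \<longleftrightarrow> x summable_on \<Lambda>"
proof
  assume "x summable_on \<Lambda>"
  then show "(\<lambda>\<alpha>. ln (1 + x \<alpha>)) summable_on \<Lambda>"
    by (rule summable_on_comparison_test) (use nonneg ln_add_one_self_le_self in auto)
next
  assume sm: "(\<lambda>\<alpha>. ln (1 + x \<alpha>)) summable_on \<Lambda>"
  define M where "M = exp (infsum (\<lambda>\<alpha>. ln (1 + x \<alpha>)) \<Lambda>)"
  show "x summable_on \<Lambda>"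
  proof (rule summable_on_comparison_test[OF summable_on_cmult_right[OF sm, of M]])
    fix \<alpha> assume a: "\<alpha> \<in> \<Lambda>"
    have "(\<Sum>\<alpha>\<in>{\<alpha>}. ln (1 + x \<alpha>)) \<le> infsum (\<lambda>\<alpha>. ln (1 + x \<alpha>)) \<Lambda>"
      using nonneg a by (intro finite_sum_le_infsum[OF sm]) auto
    then have "exp (ln (1 + x \<alpha>)) \<le> M" unfolding M_def by simp
    then have M: "1 + x \<alpha> \<le> M" using nonneg[OF a] by simp
    have "x \<alpha> \<le> (1 + x \<alpha>) * ln (1 + x \<alpha>)"
    proof -
      have "ln (1 / (1 + x \<alpha>)) \<le> 1 / (1 + x \<alpha>) - 1"
        using nonneg[OF a] by (intro ln_le_minus_one) auto
      then have "1 - 1 / (1 + x \<alpha>) \<le> ln (1 + x \<alpha>)" using nonneg[OF a] by (simp add: ln_div)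
      then show ?thesis using nonneg[OF a] by (simp add: field_simps)
    qed
    also have "\<dots> \<le> M * ln (1 + x \<alpha>)" using M nonneg[OF a] by (intro mult_right_mono) auto
    finally show "x \<alpha> \<le> M * ln (1 + x \<alpha>)" .
    show "0 \<le> x \<alpha>" using nonneg[OF a] .
  qed
qed

end

section \<open>Step functions with countably many steps: Bochner integrability\<close>

text \<open>Steps are enumerated without regard to their order on the line. Empty steps with
  \<open>l k = r k\<close> are allowed, so that finitely many steps can be padded to a sequence and
  limit points of steps need no special treatment.\<close>

locale step_partition =
  fixes a b :: real and l r :: "nat \<Rightarrow> real" and A :: "real \<Rightarrow> 'e::real_normed_vector"
  assumes ab: "a < b"
    and lr: "l k \<le> r k" and al: "a \<le> l k" and rb: "r k \<le> b"
    and disj: "i \<noteq> j \<Longrightarrow> r i \<le> l j \<or> r j \<le> l i"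
    and const: "l k \<le> t \<Longrightarrow> t < r k \<Longrightarrow> A t = A (l k)"
    and cover: "a \<le> t \<Longrightarrow> t < b \<Longrightarrow> \<exists>k. l k \<le> t \<and> t < r k"
begin

lemma step_unique: "l i \<le> t \<Longrightarrow> t < r i \<Longrightarrow> l j \<le> t \<Longrightarrow> t < r j \<Longrightarrow> i = j"
  using disj[of i j] by fastforce

definition mass :: "nat \<Rightarrow> real" where "mass k = (r k - l k) * norm (A (l k))"

definition partial :: "nat \<Rightarrow> real \<Rightarrow> 'e" where
  "partial n t = (if \<exists>k<n. l k \<le> t \<and> t < r k then A t else 0)"

lemma mass_nonneg: "0 \<le> mass k"
  using lr[of k] by (simp add: mass_def)

lemma suminf_indicator_step:
  assumes "l k \<le> t" "t < r k" "n \<le> k"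
  shows "(\<Sum>i. ennreal (norm (A (l (i + n)))) * indicator {l (i + n)..<r (i + n)} t) = ennreal (norm (A t))"
proof -
  have "(\<Sum>i. ennreal (norm (A (l (i + n)))) * indicator {l (i + n)..<r (i + n)} t) =
      (\<Sum>i\<in>{k - n}. ennreal (norm (A (l (i + n)))) * indicator {l (i + n)..<r (i + n)} t)"
  proof (rule suminf_finite)
    fix i assume "i \<notin> {k - n}"
    then have "i + n \<noteq> k" by auto
    then have "t \<notin> {l (i + n)..<r (i + n)}" using step_unique[of k t "i + n"] assms by auto
    then show "ennreal (norm (A (l (i + n)))) * indicator {l (i + n)..<r (i + n)} t = 0" by simp
  qed simp
  then show ?thesis using assms const[of k t] by simp
qed

lemma suminf_indicator_outside:
  assumes "\<And>k. n \<le> k \<Longrightarrow> \<not> (l k \<le> t \<and> t < r k)"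
  shows "(\<Sum>i. ennreal (norm (A (l (i + n)))) * indicator {l (i + n)..<r (i + n)} t) = 0"
proof -
  have "ennreal (norm (A (l (i + n)))) * indicator {l (i + n)..<r (i + n)} t = 0" for i
    using assms[of "i + n"] by (auto simp: indicator_def)
  then show ?thesis by (simp only: suminf_zero)
qed

text \<open>Disjointness leaves at most one nonzero summand. The series is measurable term by term,
  so the truncation error and, for \<open>n = 0\<close>, the norm of \<open>A\<close> itself can be
  integrated termwise.\<close>

lemma norm_diff_partial:
  assumes "a \<le> t" "t < b"
  shows "ennreal (norm (A t - partial n t)) =
    (\<Sum>i. ennreal (norm (A (l (i + n)))) * indicator {l (i + n)..<r (i + n)} t)"
proof -
  obtain k where k: "l k \<le> t" "t < r k" using cover assms by blast
  show ?thesis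
  proof (cases "n \<le> k")
    case True
    then have "\<not> (\<exists>j<n. l j \<le> t \<and> t < r j)" using step_unique[OF k] by (metis not_le)
    then have "partial n t = 0" unfolding partial_def by (rule if_not_P)
    then show ?thesis using suminf_indicator_step[OF k True] by simp
  next
    case False
    then have "partial n t = A t" using k by (auto simp: partial_def)
    moreover have "\<not> (l j \<le> t \<and> t < r j)" if "n \<le> j" for j
      using step_unique[OF k, of j] that False by auto
    ultimately show ?thesis using suminf_indicator_outside by simp
  qed
qed

lemma AE_lessThan: "AE t in lebesgue_on {a..b}. a \<le> t \<and> t < b"
proof -
  have "negligible {b}" by simp
  then have "AE t in lebesgue_on {a..b}. t \<notin> {b}"
    by (intro AE_not_in) (use ab in \<open>auto simp: negligible_iff_null_sets null_sets_restrict_space\<close>)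
  moreover have "AE t in lebesgue_on {a..b}. t \<in> {a..b}"
    by (rule AE_I2) simp
  ultimately show ?thesis by eventually_elim auto
qed

lemma sets_step: "{l k..<r k} \<in> sets (lebesgue_on {a..b})"
  using al[of k] rb[of k] by (auto simp: sets_restrict_space_iff)

lemma emeasure_step: "emeasure (lebesgue_on {a..b}) {l k..<r k} = ennreal (r k - l k)"
  using al[of k] rb[of k] lr[of k] by (subst emeasure_restrict_space) auto

lemma nn_integral_diff_partial:
  "(\<integral>\<^sup>+t. ennreal (norm (A t - partial n t)) \<partial>lebesgue_on {a..b}) = (\<Sum>i. ennreal (mass (i + n)))"
proof -
  have "(\<integral>\<^sup>+t. ennreal (norm (A t - partial n t)) \<partial>lebesgue_on {a..b}) =
      (\<integral>\<^sup>+t. (\<Sum>i. ennreal (norm (A (l (i + n)))) * indicator {l (i + n)..<r (i + n)} t) \<partial>lebesgue_on {a..b})"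
    by (rule nn_integral_cong_AE, rule eventually_mono[OF AE_lessThan])
      (use norm_diff_partial in blast)
  also have "\<dots> = (\<Sum>i. \<integral>\<^sup>+t. ennreal (norm (A (l (i + n)))) * indicator {l (i + n)..<r (i + n)} t \<partial>lebesgue_on {a..b})"
    by (rule nn_integral_suminf) (use sets_step in measurable)
  also have "\<dots> = (\<Sum>i. ennreal (mass (i + n)))"
    using sets_step emeasure_step lr
    by (simp add: nn_integral_cmult_indicator mass_def ennreal_mult'[symmetric] mult.commute)
  finally show ?thesis .
qed

lemma simple_bochner_integrable_partial:
  "Bochner_Integration.simple_bochner_integrable (lebesgue_on {a..b}) (partial n)"
proof (rule Bochner_Integration.simple_bochner_integrable.intros)
  let ?M = "lebesgue_on {a..b}"
  \<comment> \<open>\<open>c\<close> is the number of the step plus one, with 0 for points outside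
    the first \<open>n\<close> steps. \<open>partial n\<close> factors through it, so measurability
    is checked only for a function with values in \<open>nat\<close>.\<close>
  define c where "c t = (if \<exists>k<n. l k \<le> t \<and> t < r k then Suc (THE k. l k \<le> t \<and> t < r k) else 0)" for t
  have the: "(THE k. l k \<le> t \<and> t < r k) = k" if "l k \<le> t" "t < r k" for k t
    by (rule the_equality) (use that step_unique in auto)
  have c_eq: "c t = Suc k \<longleftrightarrow> k < n \<and> l k \<le> t \<and> t < r k" for t k
    unfolding c_def using the by auto
  have c_le: "c t \<le> n" for t
    unfolding c_def using the by (auto simp: Suc_le_eq)
  have "simple_function ?M c"
    unfolding simple_function_def
  proof (intro conjI ballI)
    show "finite (c ` space ?M)" by (rule finite_subset[of _ "{..n}"]) (use c_le in auto)
    have S: "c -` {Suc k} \<inter> space ?M \<in> sets ?M" for k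
    proof -
      have "c -` {Suc k} \<inter> space ?M = (if k < n then {l k..<r k} else {})"
        using c_eq al[of k] rb[of k] by (auto simp: set_eq_iff)
      then show ?thesis using sets_step by simp
    qed
    fix y assume "y \<in> c ` space ?M"
    show "c -` {y} \<inter> space ?M \<in> sets ?M"
    proof (cases y)
      case (Suc k)
      then show ?thesis using S by simp
    next
      case 0
      have "c -` {0} \<inter> space ?M = space ?M - (\<Union>k. c -` {Suc k} \<inter> space ?M)"
        by (auto dest: not0_implies_Suc)
      also have "\<dots> \<in> sets ?M" using S by (intro sets.Diff sets.countable_UN) auto
      finally show ?thesis using 0 by simp
    qed
  qed
  then have "simple_function ?M ((\<lambda>j. if j = 0 then 0 else A (l (j - 1))) \<circ> c)"
    by (rule simple_function_compose)
  moreover have "(\<lambda>j. if j = 0 then 0 else A (l (j - 1))) \<circ> c = partial n"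
    using the const by (fastforce simp: c_def partial_def fun_eq_iff)
  ultimately show "simple_function ?M (partial n)" by simp
  have "emeasure ?M {y \<in> space ?M. partial n y \<noteq> 0} \<le> emeasure ?M (space ?M)"
    by (rule emeasure_space)
  also have "\<dots> < \<infinity>" by (simp add: emeasure_restrict_space less_top[symmetric] less_imp_le[OF ab])
  finally show "emeasure ?M {y \<in> space ?M. partial n y \<noteq> 0} \<noteq> \<infinity>" by simp
qed

text \<open>The truncations are the approximating simple functions, with the tails of
  \<open>mass\<close> as errors. Conversely a single simple function at distance less than 1
  suffices, as its own norm has finite integral.\<close>

theorem bochner_integrable_iff: "bochner_integrable (lebesgue_on {a..b}) A \<longleftrightarrow> summable mass"
proof
  let ?M = "lebesgue_on {a..b}"
  assume sm: "summable mass"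
  have "(\<Sum>i. ennreal (mass (i + n))) = ennreal (\<Sum>i. mass (i + n))" for n
    using sm mass_nonneg by (intro suminf_ennreal2) (auto simp: summable_iff_shift)
  moreover have "(\<lambda>n. ennreal (\<Sum>i. mass (i + n))) \<longlonglongrightarrow> ennreal 0"
    using suminf_exist_split2[OF sm] by (intro tendsto_ennrealI) auto
  ultimately have "(\<lambda>n. \<integral>\<^sup>+t. ennreal (norm (A t - partial n t)) \<partial>?M) \<longlonglongrightarrow> 0"
    by (simp add: nn_integral_diff_partial)
  moreover have "(\<lambda>n. partial n t) \<longlonglongrightarrow> A t" if t: "a \<le> t \<and> t < b" for t
  proof -
    obtain k where k: "l k \<le> t" "t < r k" using cover t by blast
    then have "partial n t = A t" if "n \<ge> Suc k" for n using that by (auto simp: partial_def)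
    then show ?thesis by (intro tendsto_eventually eventually_sequentiallyI)
  qed
  then have "AE t in ?M. (\<lambda>n. partial n t) \<longlonglongrightarrow> A t"
    by (rule eventually_mono[OF AE_lessThan])
  ultimately show "bochner_integrable ?M A"
    unfolding bochner_integrable_def using simple_bochner_integrable_partial by blast
next
  let ?M = "lebesgue_on {a..b}"
  assume "bochner_integrable ?M A"
  then obtain s where s: "\<And>n. Bochner_Integration.simple_bochner_integrable ?M (s n)"
    and lim: "(\<lambda>n. \<integral>\<^sup>+t. ennreal (norm (A t - s n t)) \<partial>?M) \<longlonglongrightarrow> 0"
    unfolding bochner_integrable_def by blast
  have "eventually (\<lambda>n. (\<integral>\<^sup>+t. ennreal (norm (A t - s n t)) \<partial>?M) < 1) sequentially"
    using lim by (rule order_tendstoD) simp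
  then obtain n where n: "(\<integral>\<^sup>+t. ennreal (norm (A t - s n t)) \<partial>?M) < 1"
    by (auto simp: eventually_sequentially)
  \<comment> \<open>With shift 0 the series is a version of the norm of \<open>A\<close> that is
    measurable on the whole interval.\<close>
  define f where "f t = (\<Sum>i. ennreal (norm (A (l (i + 0)))) * indicator {l (i + 0)..<r (i + 0)} t)" for t
  define h where "h t = ennreal (norm (s n t))" for t
  have fm[measurable]: "f \<in> borel_measurable ?M"
    unfolding f_def using sets_step by measurable
  have sf: "simple_function ?M (s n)" and fin: "emeasure ?M {y \<in> space ?M. s n y \<noteq> 0} \<noteq> \<infinity>"
    using s[of n] by (auto elim: Bochner_Integration.simple_bochner_integrable.cases)
  have hm[measurable]: "h \<in> borel_measurable ?M"
    using borel_measurable_simple_function[OF simple_function_compose[OF sf, of "\<lambda>x. ennreal (norm x)"]]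
    unfolding h_def comp_def .
  have hfin: "(\<integral>\<^sup>+t. h t \<partial>?M) < \<infinity>"
  proof -
    define B where "B = Max (norm ` s n ` space ?M)"
    have B: "norm (s n t) \<le> B" if "t \<in> space ?M" for t
      unfolding B_def using sf that by (intro Max_ge) (auto simp: simple_function_def)
    have "(\<integral>\<^sup>+t. h t \<partial>?M) \<le> (\<integral>\<^sup>+t. ennreal B \<partial>?M)"
      unfolding h_def using B by (intro nn_integral_mono ennreal_leI) auto
    also have "\<dots> < \<infinity>" by (simp add: emeasure_restrict_space ennreal_mult_less_top less_imp_le[OF ab])
    finally show ?thesis .
  qed
  have fA: "AE t in ?M. f t = ennreal (norm (A t))"
    using AE_lessThan
  proof eventually_elim
    case (elim t)
    then have "a \<le> t" "t < b" by auto
    then show ?case using norm_diff_partial[of t 0] by (simp add: f_def partial_def)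
  qed
  \<comment> \<open>Truncated subtraction keeps the integrand measurable, so that additivity applies
    to \<open>f - h\<close> and \<open>h\<close>; for \<open>norm (A t - s n t)\<close> only
    monotonicity of the integral is used.\<close>
  have "f t - h t \<le> ennreal (norm (A t - s n t))" if "f t = ennreal (norm (A t))" for t
  proof -
    have "f t - h t = ennreal (norm (A t) - norm (s n t))"
      by (simp add: that h_def ennreal_minus)
    also have "\<dots> \<le> ennreal (norm (A t - s n t))" by (intro ennreal_leI norm_triangle_ineq2)
    finally show ?thesis .
  qed
  then have "(\<integral>\<^sup>+t. f t - h t \<partial>?M) \<le> (\<integral>\<^sup>+t. ennreal (norm (A t - s n t)) \<partial>?M)"
    by (intro nn_integral_mono_AE eventually_mono[OF fA])
  also note n
  finally have "(\<integral>\<^sup>+t. f t - h t \<partial>?M) + (\<integral>\<^sup>+t. h t \<partial>?M) < \<infinity>"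
    using hfin by (auto simp: less_top[symmetric] order_less_trans)
  moreover have "(\<integral>\<^sup>+t. f t \<partial>?M) \<le> (\<integral>\<^sup>+t. (f t - h t) + h t \<partial>?M)"
  proof (rule nn_integral_mono)
    show "f t \<le> f t - h t + h t" for t
      by (cases "h t \<le> f t") (auto simp: diff_add_cancel_ennreal intro: add_increasing)
  qed
  moreover have "\<dots> = (\<integral>\<^sup>+t. f t - h t \<partial>?M) + (\<integral>\<^sup>+t. h t \<partial>?M)"
    by (rule nn_integral_add) auto
  ultimately have "(\<integral>\<^sup>+t. f t \<partial>?M) < \<infinity>" by (simp add: order_le_less_trans)
  moreover have "(\<integral>\<^sup>+t. f t \<partial>?M) = (\<Sum>i. ennreal (mass i))"
    using nn_integral_diff_partial[of 0] nn_integral_cong_AE[OF fA] by (simp add: partial_def)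
  ultimately show "summable mass"
    using mass_nonneg by (intro summable_suminf_not_top) auto
qed

end

section \<open>Propagators of step functions\<close>

lemma exp_scaleR_mult_exp_minus:
  fixes z :: "'e::{real_normed_algebra_1, banach}"
  shows "exp (s *\<^sub>R z) * exp (- (t *\<^sub>R z)) = exp ((s - t) *\<^sub>R z)"
  by (subst exp_add_commuting[symmetric]) (simp_all add: scaleR_diff_left)

text \<open>Both sides are exponential series without the constant term, compared term by
  term.\<close>

lemma norm_exp_minus_one_le:
  fixes x :: "'e::{real_normed_algebra_1, banach}"
  shows "norm (exp x - 1) \<le> exp (norm x) - 1"
proof -
  have sm: "summable (\<lambda>n. norm (x ^ Suc n /\<^sub>R fact (Suc n)))"
    using summable_norm_exp[of x] by (subst summable_Suc_iff)
  have "exp x - 1 = (\<Sum>n. x ^ Suc n /\<^sub>R fact (Suc n))"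
    using suminf_split_head[OF summable_exp_generic[of x]] by (simp add: exp_def)
  also have "norm \<dots> \<le> (\<Sum>n. norm (x ^ Suc n /\<^sub>R fact (Suc n)))"
    by (rule summable_norm[OF sm])
  also have "\<dots> \<le> (\<Sum>n. norm x ^ Suc n /\<^sub>R fact (Suc n))"
  proof (rule suminf_le[OF _ sm])
    show "norm (x ^ Suc n /\<^sub>R fact (Suc n)) \<le> norm x ^ Suc n /\<^sub>R fact (Suc n)" for n
      using norm_power_ineq[of x "Suc n"] by (simp add: divide_right_mono del: power_Suc)
    show "summable (\<lambda>n. norm x ^ Suc n /\<^sub>R fact (Suc n))"
      using summable_exp_generic[of "norm x"] by (subst summable_Suc_iff)
  qed
  also have "\<dots> = exp (norm x) - 1"
    using suminf_split_head[OF summable_exp_generic[of "norm x"]] by (simp add: exp_def)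
  finally show ?thesis .
qed

locale step_partition_algebra = step_partition a b l r A
  for a b :: real and l r :: "nat \<Rightarrow> real" and A :: "real \<Rightarrow> 'e::{real_normed_algebra_1, banach}"
begin

text \<open>The length of the part of step \<open>k\<close> to the left of \<open>t\<close>, that
  is, the time during which the step has acted by \<open>t\<close>.\<close>

definition covered :: "nat \<Rightarrow> real \<Rightarrow> real" where
  "covered k t = max 0 (min (t - l k) (r k - l k))"

lemma covered_nonneg: "0 \<le> covered k t" and covered_le: "covered k t \<le> r k - l k"
  using lr[of k] by (auto simp: covered_def)

lemma covered_mono: "u \<le> v \<Longrightarrow> covered k u \<le> covered k v"
  by (auto simp: covered_def)

lemma covered_a [simp]: "covered k a = 0"
  using al[of k] by (auto simp: covered_def)

lemma covered_other:
  assumes "i \<noteq> j" "u \<in> {l j..r j}" "v \<in> {l j..r j}"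
  shows "covered i u = covered i v"
  using disj[OF assms(1)] assms lr[of i] by (auto simp: covered_def)

lemma covered_self: "u \<in> {l j..r j} \<Longrightarrow> covered j u = u - l j"
  by (auto simp: covered_def)

text \<open>A step that acts between \<open>u\<close> and \<open>v\<close> supplies a pivot lying
  between them, at which changes of the monotone function \<open>F n\<close> split
  additively.\<close>

lemma covered_neq_imp:
  assumes "covered k u \<noteq> covered k v"
  shows "\<exists>p\<in>{l k..r k}. u \<le> p \<and> p \<le> v \<or> v \<le> p \<and> p \<le> u"
proof (cases "u \<le> v")
  case True
  then show ?thesis using assms lr[of k]
    by (intro bexI[of _ "max u (l k)"]) (auto simp: covered_def max_def min_def split: if_splits)
next
  case False
  then show ?thesis using assms lr[of k]
    by (intro bexI[of _ "max v (l k)"]) (auto simp: covered_def max_def min_def split: if_splits)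
qed

text \<open>
  The solutions of $W' = A W$ and $Q' = - Q A$ with value 1 at \<open>a\<close>, for \<open>A\<close> cut off to its first
  \<open>n\<close> steps. To switch on step \<open>n\<close>, multiply the propagator from \<open>l n\<close> to \<open>t\<close>, the exponential over
  the part of the step to the left of \<open>t\<close>, and the propagator from \<open>a\<close> to \<open>l n\<close>; this is also right
  for \<open>t \<le> l n\<close>, because the exponential is then 1.
\<close>

primrec sol :: "nat \<Rightarrow> real \<Rightarrow> 'e \<times> 'e" where
  "sol 0 = (\<lambda>t. (1, 1))"
| "sol (Suc n) = (\<lambda>t.
     (fst (sol n t) * (snd (sol n (l n)) * (exp (covered n t *\<^sub>R A (l n)) * fst (sol n (l n)))),
      snd (sol n (l n)) * (exp (- (covered n t *\<^sub>R A (l n))) * (fst (sol n (l n)) * snd (sol n t)))))"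

abbreviation W where "W n t \<equiv> fst (sol n t)"
abbreviation Q where "Q n t \<equiv> snd (sol n t)"

definition F :: "nat \<Rightarrow> real \<Rightarrow> real" where
  "F n t = (\<Sum>k<n. norm (A (l k)) * covered k t)"

lemma F_Suc: "F (Suc n) t = F n t + norm (A (l n)) * covered n t"
  by (simp add: F_def)

lemma F_mono: "u \<le> v \<Longrightarrow> F n u \<le> F n v"
  unfolding F_def by (intro sum_mono mult_left_mono covered_mono) auto

lemma sol_inverse: "W n t * Q n t = 1" "Q n t * W n t = 1"
proof (induction n arbitrary: t)
  case (Suc n)
  have c: "W n s * (Q n s * x) = x" "Q n s * (W n s * x) = x" for s x
    by (simp_all add: Suc mult.assoc[symmetric])
  have e: "exp y * (exp (- y) * x) = x" "exp (- y) * (exp y * x) = x" for x y :: 'e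
    using exp_minus_inverse[of "- y"] by (simp_all add: exp_minus_inverse mult.assoc[symmetric])
  {
    case 1
    show ?case by (simp add: c e Suc mult.assoc)
  next
    case 2
    show ?case by (simp add: c e Suc mult.assoc)
  }
qed simp_all

text \<open>Step \<open>j\<close> is switched on only at stage \<open>j + 1\<close>, and the earlier
  steps do not overlap it, so nothing changes while it is traversed.\<close>

lemma sol_const:
  assumes "n \<le> j" "u \<in> {l j..r j}" "v \<in> {l j..r j}"
  shows "sol n u = sol n v"
  using assms(1)
proof (induction n)
  case (Suc n)
  then show ?case using covered_other[of n j u v] assms by simp
qed simp

lemma sol_a: "sol n a = (1, 1)"
  by (induction n) (simp_all add: sol_inverse)

text \<open>The inner factors \<open>W n (l n)\<close> and \<open>Q n (l n)\<close> cancel and the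
  exponentials combine. The pivot \<open>l n\<close> may then be moved to any \<open>p\<close> of
  the step, as \<open>sol n\<close> is constant there.\<close>

lemma propagator_Suc:
  assumes "p \<in> {l n..r n}"
  shows "W (Suc n) v * Q (Suc n) u =
    W n v * Q n p * exp ((covered n v - covered n u) *\<^sub>R A (l n)) * (W n p * Q n u)"
proof -
  have c: "W n s * (Q n s * x) = x" for s x by (simp add: sol_inverse mult.assoc[symmetric])
  have e: "exp (s *\<^sub>R z) * (exp (- (t *\<^sub>R z)) * x) = exp ((s - t) *\<^sub>R z) * x" for s t and z x :: 'e
    by (simp only: exp_scaleR_mult_exp_minus mult.assoc[symmetric])
  have "sol n p = sol n (l n)" using sol_const[of n n p "l n"] assms by auto
  then show ?thesis by (simp add: c e mult.assoc)
qed

lemma propagator_Suc_eq: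
  assumes "covered n u = covered n v"
  shows "W (Suc n) v * Q (Suc n) u = W n v * Q n u"
proof -
  have c: "Q n s * (W n s * x) = x" for s x by (simp add: sol_inverse mult.assoc[symmetric])
  show ?thesis using propagator_Suc[of "l n" n v u] lr[of n] assms by (simp add: c mult.assoc)
qed

text \<open>The norm bound at stage \<open>n\<close> gives the increment bound, and the sum of the
  two is the norm bound at stage \<open>n + 1\<close>. Absolute values cover propagators running
  backward, among them \<open>Q n u\<close>, which is the case \<open>v = a\<close>.\<close>

lemma propagator_bounds:
  shows "norm (W n v * Q n u) \<le> exp \<bar>F n v - F n u\<bar>"
    and "norm (W (Suc n) v * Q (Suc n) u - W n v * Q n u) \<le>
      exp \<bar>F (Suc n) v - F (Suc n) u\<bar> - exp \<bar>F n v - F n u\<bar>"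
proof -
  have step: "norm (W (Suc n) v * Q (Suc n) u - W n v * Q n u) \<le>
      exp \<bar>F (Suc n) v - F (Suc n) u\<bar> - exp \<bar>F n v - F n u\<bar>"
    if bound: "\<And>u v. norm (W n v * Q n u) \<le> exp \<bar>F n v - F n u\<bar>" for n u v
  proof (cases "covered n u = covered n v")
    case True
    then show ?thesis using propagator_Suc_eq[OF True] by (simp add: F_Suc)
  next
    case False
    then obtain p where p: "p \<in> {l n..r n}" "u \<le> p \<and> p \<le> v \<or> v \<le> p \<and> p \<le> u"
      using covered_neq_imp by blast
    define d where "d = covered n v - covered n u"
    define E where "E = exp (d *\<^sub>R A (l n))"
    have c: "Q n s * (W n s * x) = x" for s x by (simp add: sol_inverse mult.assoc[symmetric])
    have E1: "norm (E - 1) \<le> exp (\<bar>d\<bar> * norm (A (l n))) - 1"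
      using norm_exp_minus_one_le[of "d *\<^sub>R A (l n)"] by (simp add: E_def)
    have E0: "0 \<le> exp (\<bar>d\<bar> * norm (A (l n))) - 1" by simp
    \<comment> \<open>The old propagator is the same product with 1 in place of
      \<open>E\<close>.\<close>
    have eq: "W (Suc n) v * Q (Suc n) u - W n v * Q n u = W n v * Q n p * (E - 1) * (W n p * Q n u)"
      unfolding propagator_Suc[OF p(1)] E_def d_def by (simp add: c algebra_simps)
    have "norm (W (Suc n) v * Q (Suc n) u - W n v * Q n u) \<le>
        norm (W n v * Q n p) * norm (E - 1) * norm (W n p * Q n u)"
      unfolding eq by (rule order_trans[OF norm_mult_ineq mult_right_mono[OF norm_mult_ineq norm_ge_zero]])
    also have "\<dots> \<le> exp \<bar>F n v - F n p\<bar> * (exp (\<bar>d\<bar> * norm (A (l n))) - 1) * exp \<bar>F n p - F n u\<bar>"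
      by (rule mult_mono[OF mult_mono[OF bound E1] bound])
        (intro exp_ge_zero norm_ge_zero mult_nonneg_nonneg E0)+
    also have "\<dots> = exp (\<bar>F n v - F n p\<bar> + \<bar>F n p - F n u\<bar>) * (exp (\<bar>d\<bar> * norm (A (l n))) - 1)"
      by (simp add: exp_add)
    \<comment> \<open>As \<open>p\<close> lies between \<open>u\<close> and \<open>v\<close>, the
      two changes of \<open>F n\<close> have the same sign.\<close>
    also have "\<bar>F n v - F n p\<bar> + \<bar>F n p - F n u\<bar> = \<bar>F n v - F n u\<bar>"
      using p(2) F_mono[of u p n] F_mono[of p v n] F_mono[of v p n] F_mono[of p u n] by linarith
    also have "exp \<bar>F n v - F n u\<bar> * (exp (\<bar>d\<bar> * norm (A (l n))) - 1) =
        exp (\<bar>F n v - F n u\<bar> + \<bar>d\<bar> * norm (A (l n))) - exp \<bar>F n v - F n u\<bar>"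
      by (simp add: exp_add algebra_simps)
    also have "\<bar>F n v - F n u\<bar> + \<bar>d\<bar> * norm (A (l n)) = \<bar>F (Suc n) v - F (Suc n) u\<bar>"
    proof (cases "u \<le> v")
      case True
      then have "F n u \<le> F n v" "0 \<le> d" using F_mono covered_mono by (auto simp: d_def)
      then show ?thesis
        using mult_nonneg_nonneg[of d "norm (A (l n))"] unfolding F_Suc d_def
        by (simp add: algebra_simps)
    next
      case False
      then have "F n v \<le> F n u" "d \<le> 0"
        using F_mono[of v u] covered_mono[of v u] by (auto simp: d_def)
      then show ?thesis
        using mult_nonneg_nonneg[of "- d" "norm (A (l n))"] unfolding F_Suc d_def
        by (simp add: algebra_simps)
    qed
    finally show ?thesis .
  qed
  have bound: "norm (W n v * Q n u) \<le> exp \<bar>F n v - F n u\<bar>" for n u v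
  proof (induction n arbitrary: u v)
    case 0
    then show ?case by (simp add: F_def)
  next
    case (Suc n)
    show ?case using step[OF Suc, of v u] Suc[of v u]
        norm_triangle_sub[of "W (Suc n) v * Q (Suc n) u" "W n v * Q n u"] by linarith
  qed
  show "norm (W n v * Q n u) \<le> exp \<bar>F n v - F n u\<bar>" by (rule bound)
  show "norm (W (Suc n) v * Q (Suc n) u - W n v * Q n u) \<le>
      exp \<bar>F (Suc n) v - F (Suc n) u\<bar> - exp \<bar>F n v - F n u\<bar>" by (rule step[OF bound])
qed

lemma propagator_diff:
  assumes "n \<le> m"
  shows "norm (W m v * Q m u - W n v * Q n u) \<le> exp \<bar>F m v - F m u\<bar> - exp \<bar>F n v - F n u\<bar>"
  using assms
proof (induction m rule: dec_induct)
  case (step m)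
  have "norm (W (Suc m) v * Q (Suc m) u - W n v * Q n u) \<le>
      norm (W (Suc m) v * Q (Suc m) u - W m v * Q m u) + norm (W m v * Q m u - W n v * Q n u)"
    using norm_triangle_ineq[of "W (Suc m) v * Q (Suc m) u - W m v * Q m u" "W m v * Q m u - W n v * Q n u"]
    by simp
  then show ?case using propagator_bounds(2)[of m v u] step.IH by linarith
qed simp

text \<open>At stage \<open>j + 1\<close> the old propagators within step \<open>j\<close> are 1 and
  only the exponential remains; later steps are disjoint from it and do not alter it.\<close>

lemma propagator_step:
  assumes "j < n" "u \<in> {l j..r j}" "v \<in> {l j..r j}"
  shows "W n v * Q n u = exp ((v - u) *\<^sub>R A (l j))"
  using Suc_leI[OF assms(1)]
proof (induction n rule: dec_induct)
  case base
  have "W j v * Q j u = 1" "W j u * Q j u = 1"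
    using sol_const[of j j u v] assms by (auto simp: sol_inverse)
  then show ?case
    using propagator_Suc[of u j v u] assms sol_const[of j j u v] by (simp add: covered_self sol_inverse)
next
  case (step n)
  then show ?case using propagator_Suc_eq[of n u v] covered_other[of n j u v] assms by simp
qed

end

section \<open>Strong product integrability of summable step functions\<close>

lemma sum_telescope_1: "(\<Sum>i=1..m. f i - f (i - 1)) = f m - f (0::nat)" for f :: "nat \<Rightarrow> real"
  by (induction m) auto

text \<open>Clamping the points to \<open>[p, q]\<close> does not affect the selected intervals and
  leaves all other increments nonnegative, so the telescoping sum over all intervals is an upper
  bound.\<close>

lemma sum_mono_increments_le:
  fixes G :: "real \<Rightarrow> real" and t :: "nat \<Rightarrow> real"
  assumes "mono G" "I \<subseteq> {1..m}" "p \<le> q"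
    and "\<And>i. i \<in> {1..m} \<Longrightarrow> t (i - 1) \<le> t i"
    and "\<And>i. i \<in> I \<Longrightarrow> p \<le> t (i - 1) \<and> t i \<le> q"
  shows "(\<Sum>i\<in>I. G (t i) - G (t (i - 1))) \<le> G q - G p"
proof -
  define c where "c x = max p (min q x)" for x
  have c: "c x = x" if "p \<le> x" "x \<le> q" for x using that by (auto simp: c_def)
  have "(\<Sum>i\<in>I. G (t i) - G (t (i - 1))) = (\<Sum>i\<in>I. G (c (t i)) - G (c (t (i - 1))))"
  proof (rule sum.cong)
    fix i assume "i \<in> I"
    then have "p \<le> t (i - 1)" "t (i - 1) \<le> t i" "t i \<le> q" using assms by blast+
    then show "G (t i) - G (t (i - 1)) = G (c (t i)) - G (c (t (i - 1)))" by (simp add: c)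
  qed simp
  also have "\<dots> \<le> (\<Sum>i=1..m. G (c (t i)) - G (c (t (i - 1))))"
  proof (rule sum_mono2)
    fix i assume "i \<in> {1..m} - I"
    then have "c (t (i - 1)) \<le> c (t i)" using assms(4)[of i] by (auto simp: c_def)
    then show "0 \<le> G (c (t i)) - G (c (t (i - 1)))" using \<open>mono G\<close> by (simp add: monoD)
  qed (use assms in auto)
  also have "\<dots> = G (c (t m)) - G (c (t 0))" by (rule sum_telescope_1)
  also have "\<dots> \<le> G q - G p"
    using \<open>mono G\<close> \<open>p \<le> q\<close> by (intro diff_mono monoD[OF \<open>mono G\<close>]) (auto simp: c_def)
  finally show ?thesis .
qed

lemma sum_half_powers_le:
  assumes "inj_on f S" "finite S"
  shows "(\<Sum>d\<in>S. (1/2) ^ f d) \<le> (2::real)"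
proof -
  have "(\<Sum>d\<in>S. (1/2) ^ f d) = (\<Sum>n\<in>f ` S. (1/2) ^ n :: real)"
    using assms by (simp add: sum.reindex)
  also have "\<dots> \<le> (\<Sum>n. (1/2) ^ n)"
    using assms by (intro sum_le_suminf summable_geometric) auto
  also have "\<dots> = 2" by (subst suminf_geometric) auto
  finally show ?thesis .
qed

lemma isCont_small_increment:
  fixes G :: "real \<Rightarrow> real"
  assumes "isCont G x" "e > 0"
  shows "\<exists>d>0. G (x + d) - G (x - d) \<le> e"
proof -
  obtain d where d: "d > 0" "\<And>y. dist y x < d \<Longrightarrow> dist (G y) (G x) < e / 2"
    using assms unfolding continuous_at_eps_delta by (metis half_gt_zero)
  have "dist (G (x + d/2)) (G x) < e/2" "dist (G (x - d/2)) (G x) < e/2"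
    by (rule d(2), use d(1) in \<open>simp add: dist_real_def\<close>)+
  then have "G (x + d/2) - G (x - d/2) \<le> e" unfolding dist_real_def by linarith
  then show ?thesis using d(1) by (intro exI[of _ "d/2"]) auto
qed

lemma exp_scaleR_linearization:
  fixes z :: "'e::{real_normed_algebra_1, banach}"
  assumes "e > 0"
  shows "\<exists>\<rho>>0. \<forall>h. 0 \<le> h \<and> h < \<rho> \<longrightarrow> norm (1 + h *\<^sub>R z - exp (h *\<^sub>R z)) \<le> e * h"
proof -
  have "((\<lambda>t. exp (t *\<^sub>R z)) has_vector_derivative exp (0 *\<^sub>R z) * z) (at 0)"
    by (rule exp_scaleR_has_vector_derivative_right)
  then obtain d where d: "d > 0"
    "\<And>y. norm (y - 0) < d \<Longrightarrow> norm (exp (y *\<^sub>R z) - exp (0 *\<^sub>R z) - (y - 0) *\<^sub>R z) \<le> e * norm (y - 0)"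
    using assms unfolding has_vector_derivative_def has_derivative_at_alt by auto
  have "norm (1 + h *\<^sub>R z - exp (h *\<^sub>R z)) \<le> e * h" if "0 \<le> h" "h < d" for h
    using d(2)[of h] that norm_minus_commute[of "1 + h *\<^sub>R z" "exp (h *\<^sub>R z)"]
    by (simp add: algebra_simps)
  then show ?thesis using d(1) by blast
qed

lemma alg_inverse_eq:
  assumes "x * y = 1" "y * x = 1"
  shows "alg_inverse x = y"
  unfolding alg_inverse_def
proof (rule the_equality)
  fix y' assume "x * y' = 1 \<and> y' * x = 1"
  then have "y' = y' * (x * y)" "y' * x = 1" using assms by auto
  then show "y' = y" by (simp add: mult.assoc[symmetric])
qed (use assms in simp)

lemma free_tagged_partition_mono:
  assumes "free_tagged_partition a b m t \<xi>" "i \<le> j" "j \<le> m"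
  shows "t i \<le> t j"
  using assms(2,3)
proof (induction j rule: dec_induct)
  case (step j)
  then have "Suc j \<in> {1..m}" by simp
  then have "t (Suc j - 1) < t (Suc j)" using assms(1) unfolding free_tagged_partition_def by blast
  then show ?case using step by simp
qed simp

section \<open>Limit propagators and a gauge for them\<close>

context step_partition_algebra
begin

context
  assumes sm: "summable mass"
begin

definition Flim :: "real \<Rightarrow> real" where
  "Flim t = (\<Sum>k. norm (A (l k)) * covered k t)"

lemma norm_covered_le: "norm (norm (A (l k)) * covered k t) \<le> mass k"
  using covered_le[of k t] covered_nonneg[of k t]
  by (simp add: mass_def abs_mult mult.commute mult_left_mono)

lemma summable_covered: "summable (\<lambda>k. norm (A (l k)) * covered k t)"
  by (rule summable_comparison_test'[OF sm norm_covered_le])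

lemma F_lim: "(\<lambda>n. F n t) \<longlonglongrightarrow> Flim t"
  unfolding F_def Flim_def by (rule summable_LIMSEQ[OF summable_covered])

lemma mono_Flim: "mono Flim"
  unfolding Flim_def by (intro monoI suminf_le mult_left_mono covered_mono summable_covered) auto

lemma Flim_nonneg: "0 \<le> Flim t"
  unfolding Flim_def by (intro suminf_nonneg summable_covered mult_nonneg_nonneg covered_nonneg) auto

lemma Flim_le: "Flim t \<le> suminf mass"
  unfolding Flim_def using norm_covered_le[of _ t]
  by (intro suminf_le summable_covered sm) (auto intro: order_trans[OF abs_ge_self])

lemma abs_Flim_diff_le: "\<bar>Flim v - Flim u\<bar> \<le> suminf mass"
  using Flim_nonneg[of u] Flim_nonneg[of v] Flim_le[of u] Flim_le[of v] by linarith

text \<open>\<open>mass\<close> is a summable majorant, so the series of continuous functions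
  converges uniformly. Continuity is what makes intervals near an exceptional tag cheap.\<close>

lemma isCont_Flim: "isCont Flim t"
proof -
  have "uniform_limit UNIV (\<lambda>n t. \<Sum>k<n. norm (A (l k)) * covered k t) Flim sequentially"
    unfolding Flim_def by (rule Weierstrass_m_test[OF norm_covered_le sm])
  then have "continuous_on UNIV Flim"
    by (rule uniform_limit_theorem[rotated])
      (auto simp: covered_def intro!: always_eventually continuous_intros)
  then show ?thesis by (simp add: continuous_on_eq_continuous_at)
qed

text \<open>By \<open>propagator_diff\<close> the distances are dominated by those of a convergent
  real sequence.\<close>

lemma convergent_propagator: "convergent (\<lambda>n. W n v * Q n u)"
proof (rule Cauchy_convergent, rule CauchyI)
  define e where "e n = exp \<bar>F n v - F n u\<bar>" for n
  fix \<epsilon> :: real assume "\<epsilon> > 0"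
  have "e \<longlonglongrightarrow> exp \<bar>Flim v - Flim u\<bar>"
    unfolding e_def by (intro tendsto_intros F_lim)
  then have "Cauchy e" by (rule LIMSEQ_imp_Cauchy)
  then obtain N where N: "\<And>m n. m \<ge> N \<Longrightarrow> n \<ge> N \<Longrightarrow> norm (e m - e n) < \<epsilon>"
    using CauchyD[OF _ \<open>\<epsilon> > 0\<close>] by blast
  have "norm (W m v * Q m u - W n v * Q n u) < \<epsilon>" if "m \<ge> N" "n \<ge> N" for m n
  proof (cases "n \<le> m")
    case True
    then show ?thesis using propagator_diff[OF True, of v u] N[OF that] by (auto simp: e_def)
  next
    case False
    then show ?thesis using propagator_diff[of m n v u] N[OF that]
      by (auto simp: e_def norm_minus_commute)
  qed
  then show "\<exists>M. \<forall>m\<ge>M. \<forall>n\<ge>M. norm (W m v * Q m u - W n v * Q n u) < \<epsilon>" by blast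
qed

definition Wlim where "Wlim t = lim (\<lambda>n. W n t)"
definition Qlim where "Qlim t = lim (\<lambda>n. Q n t)"

text \<open>\<open>W n t\<close> and \<open>Q n t\<close> are the propagators from and to
  \<open>a\<close>, since both components of \<open>sol n\<close> are 1 there.\<close>

lemma W_lim: "(\<lambda>n. W n t) \<longlonglongrightarrow> Wlim t" and Q_lim: "(\<lambda>n. Q n t) \<longlonglongrightarrow> Qlim t"
  using convergent_propagator[of t a] convergent_propagator[of a t]
  by (simp_all add: sol_a Wlim_def Qlim_def convergent_LIMSEQ_iff)

lemma propagator_lim: "(\<lambda>n. W n v * Q n u) \<longlonglongrightarrow> Wlim v * Qlim u"
  by (intro tendsto_mult W_lim Q_lim)

lemma Wlim_inverse: "Wlim t * Qlim t = 1" "Qlim t * Wlim t = 1"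
  using LIMSEQ_unique[OF propagator_lim[of t t]] LIMSEQ_unique[OF tendsto_mult[OF Q_lim W_lim, of t t]]
  by (simp_all add: sol_inverse)

lemma Wlim_a: "Wlim a = 1" and Qlim_a: "Qlim a = 1"
  using LIMSEQ_unique[OF W_lim[of a]] LIMSEQ_unique[OF Q_lim[of a]] by (simp_all add: sol_a)

text \<open>Stage 0 has propagator 1 and \<open>F 0\<close> is 0, so this is the limit of the
  telescoped estimate started there.\<close>

lemma norm_propagator_lim_minus_one: "norm (Wlim v * Qlim u - 1) \<le> exp \<bar>Flim v - Flim u\<bar> - 1"
proof (rule LIMSEQ_le)
  show "(\<lambda>n. norm (W n v * Q n u - 1)) \<longlonglongrightarrow> norm (Wlim v * Qlim u - 1)"
    by (intro tendsto_intros propagator_lim)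
  show "(\<lambda>n. exp \<bar>F n v - F n u\<bar> - 1) \<longlonglongrightarrow> exp \<bar>Flim v - Flim u\<bar> - 1"
    by (intro tendsto_intros F_lim)
  show "\<exists>N. \<forall>n\<ge>N. norm (W n v * Q n u - 1) \<le> exp \<bar>F n v - F n u\<bar> - 1"
    using propagator_diff[of 0 _ v u] by (simp add: F_def)
qed

lemma norm_propagator_lim_le: "norm (Wlim v * Qlim u) \<le> exp (suminf mass)"
proof -
  have "norm (Wlim v * Qlim u) \<le> norm (Wlim v * Qlim u - 1) + norm (1::'e)"
    by (metis norm_triangle_sub add.commute)
  also have "\<dots> \<le> exp \<bar>Flim v - Flim u\<bar>" using norm_propagator_lim_minus_one[of v u] by simp
  also have "\<dots> \<le> exp (suminf mass)" using abs_Flim_diff_le by simp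
  finally show ?thesis .
qed

lemma propagator_lim_step:
  assumes "u \<in> {l j..r j}" "v \<in> {l j..r j}"
  shows "Wlim v * Qlim u = exp ((v - u) *\<^sub>R A (l j))"
proof (rule LIMSEQ_unique[OF propagator_lim])
  show "(\<lambda>n. W n v * Q n u) \<longlonglongrightarrow> exp ((v - u) *\<^sub>R A (l j))"
    using propagator_step[OF _ assms]
    by (intro tendsto_eventually eventually_sequentiallyI[of "Suc j"]) auto
qed

text \<open>From \<open>1 - x \<le> exp (- x)\<close> follows
  \<open>exp x - 1 \<le> exp x * x\<close>. A bound linear in the increment of \<open>Flim\<close>
  can be added up over intervals.\<close>

lemma norm_propagator_lim_minus_one_le:
  assumes "u \<le> v"
  shows "norm (Wlim v * Qlim u - 1) \<le> exp (suminf mass) * (Flim v - Flim u)"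
proof -
  define x where "x = Flim v - Flim u"
  have x: "0 \<le> x" "x \<le> suminf mass" 
    using monoD[OF mono_Flim assms] abs_Flim_diff_le[of v u] by (auto simp: x_def)
  have "exp x * (1 - x) \<le> exp x * exp (- x)"
    using exp_ge_add_one_self[of "- x"] by (intro mult_left_mono) auto
  then have "exp x - 1 \<le> exp x * x" by (simp add: exp_minus algebra_simps)
  also have "\<dots> \<le> exp (suminf mass) * x" using x by (intro mult_right_mono) auto
  finally show ?thesis using norm_propagator_lim_minus_one[of v u] x by (simp add: x_def)
qed

text \<open>Tags in \<open>D\<close> are charged to increments of a continuous monotone function,
  all other tags to the linearization error of one exponential. The total is at most
  \<open>\<epsilon> / 2 + \<epsilon> / 4\<close>.\<close>

lemma strongly_integrable_gauge:
  assumes "\<epsilon> > 0"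
  shows "\<exists>\<delta>. (\<forall>x\<in>{a..b}. 0 < \<delta> x) \<and>
    (\<forall>m t \<xi>. free_tagged_partition a b m t \<xi> \<and> delta_fine \<delta> m t \<xi> \<longrightarrow>
      (\<Sum>i=1..m. norm (1 + (t i - t (i - 1)) *\<^sub>R A (\<xi> i) - Wlim (t i) * Qlim (t (i - 1)))) < \<epsilon>)"
proof -
  define C where "C = exp (suminf mass)"
  \<comment> \<open>Every tag in \<open>[a, b]\<close> outside this countable set is interior to a
    step.\<close>
  define D where "D = insert b (range l)"
  \<comment> \<open>An increment of \<open>G x\<close> bounds the error of an interval with tag
    \<open>x\<close>: the first summand takes the Riemann term, the second the distance of the
    propagator from 1.\<close>
  define G where "G x t = norm (A x) * t + C * Flim t" for x t
  \<comment> \<open>Over distinct tags of \<open>D\<close> these weights sum to at most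
    \<open>\<epsilon> / 2\<close>; \<open>e\<close> is chosen so that the remaining tags contribute
    at most \<open>\<epsilon> / 4\<close>.\<close>
  define w where "w x = \<epsilon> / 4 * (1/2) ^ to_nat_on D x" for x
  define e where "e = \<epsilon> / 4 / (b - a)"
  have e: "e > 0" using assms ab by (simp add: e_def)
  have C: "C > 0" by (simp add: C_def)
  have D: "countable D" by (simp add: D_def)
  have mono_G: "mono (G x)" for x
    using C unfolding G_def by (intro monoI add_mono mult_left_mono monoD[OF mono_Flim]) auto
  have "\<exists>d>0. G x (x + d) - G x (x - d) \<le> w x" for x
    using assms unfolding G_def
    by (intro isCont_small_increment continuous_intros isCont_Flim) (auto simp: w_def)
  then obtain d1 where d1: "\<And>x. d1 x > 0" "\<And>x. G x (x + d1 x) - G x (x - d1 x) \<le> w x"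
    by metis
  have "\<exists>d>0. \<exists>k. {x - d<..<x + d} \<subseteq> {l k<..<r k} \<and>
      (\<forall>h. 0 \<le> h \<and> h < 2 * d \<longrightarrow> norm (1 + h *\<^sub>R A x - exp (h *\<^sub>R A (l k))) \<le> e * h)"
    if x: "x \<in> {a..b} - D" for x
  proof -
    obtain k where k: "l k \<le> x" "x < r k" using cover[of x] x by (auto simp: D_def)
    then have k': "l k < x" using x by (auto simp: D_def order_less_le)
    obtain \<rho> where \<rho>: "\<rho> > 0"
      "\<And>h. 0 \<le> h \<Longrightarrow> h < \<rho> \<Longrightarrow> norm (1 + h *\<^sub>R A (l k) - exp (h *\<^sub>R A (l k))) \<le> e * h"
      using exp_scaleR_linearization[OF e, of "A (l k)"] by blast
    \<comment> \<open>An interval inside \<open>(x - d, x + d)\<close> has length below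
      \<open>2 * d\<close>, hence the half of \<rho>; the other two bounds keep it inside the
      step.\<close>
    define d where "d = min (\<rho> / 2) (min (x - l k) (r k - x))"
    have "d > 0" "d \<le> \<rho> / 2" "{x - d<..<x + d} \<subseteq> {l k<..<r k}"
      unfolding d_def using k k' \<rho>(1) by (simp, intro min.cobounded1, auto)
    then have "d > 0" "2 * d \<le> \<rho>" "{x - d<..<x + d} \<subseteq> {l k<..<r k}" by auto
    then show ?thesis using \<rho>(2) const[OF k] by (metis order_less_le_trans)
  qed
  then obtain d2 where d2: "\<And>x. x \<in> {a..b} - D \<Longrightarrow> d2 x > 0"
    "\<And>x. x \<in> {a..b} - D \<Longrightarrow> \<exists>k. {x - d2 x<..<x + d2 x} \<subseteq> {l k<..<r k} \<and>
      (\<forall>h. 0 \<le> h \<and> h < 2 * d2 x \<longrightarrow> norm (1 + h *\<^sub>R A x - exp (h *\<^sub>R A (l k))) \<le> e * h)"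
    by metis
  define \<delta> where "\<delta> x = (if x \<in> D then d1 x else d2 x)" for x
  have "(\<Sum>i=1..m. norm (1 + (t i - t (i - 1)) *\<^sub>R A (\<xi> i) - Wlim (t i) * Qlim (t (i - 1)))) < \<epsilon>"
    if part: "free_tagged_partition a b m t \<xi>" and fine: "delta_fine \<delta> m t \<xi>" for m t \<xi>
  proof -
    define T where "T i = norm (1 + (t i - t (i - 1)) *\<^sub>R A (\<xi> i) - Wlim (t i) * Qlim (t (i - 1)))" for i
    define I where "I = {i \<in> {1..m}. \<xi> i \<in> D}"
    have I: "I \<subseteq> {1..m}" "finite I" by (auto simp: I_def)
    have less: "t (i - 1) < t i" and tag: "\<xi> i \<in> {a..b}" if "i \<in> {1..m}" for i
      using part that unfolding free_tagged_partition_def by blast+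
    have near: "\<xi> i - \<delta> (\<xi> i) < t (i - 1)" "t i < \<xi> i + \<delta> (\<xi> i)" if "i \<in> {1..m}" for i
    proof -
      have "{t (i - 1)..t i} \<subseteq> {\<xi> i - \<delta> (\<xi> i)<..<\<xi> i + \<delta> (\<xi> i)}"
        using fine that unfolding delta_fine_def by blast
      moreover have "t (i - 1) \<in> {t (i - 1)..t i}" "t i \<in> {t (i - 1)..t i}" using less[OF that] by auto
      ultimately show "\<xi> i - \<delta> (\<xi> i) < t (i - 1)" "t i < \<xi> i + \<delta> (\<xi> i)"
        unfolding subset_eq greaterThanLessThan_iff by blast+
    qed
    have "(\<Sum>i\<in>I. T i) \<le> (\<Sum>i\<in>I. G (\<xi> i) (t i) - G (\<xi> i) (t (i - 1)))"
    proof (rule sum_mono)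
      fix i assume i: "i \<in> I"
      then have lt: "t (i - 1) < t i" using less I by blast
      have "T i \<le> norm ((t i - t (i - 1)) *\<^sub>R A (\<xi> i)) + norm (Wlim (t i) * Qlim (t (i - 1)) - 1)"
        unfolding T_def
        using norm_triangle_ineq4[of "(t i - t (i - 1)) *\<^sub>R A (\<xi> i)" "Wlim (t i) * Qlim (t (i - 1)) - 1"]
        by (simp add: algebra_simps)
      also have "\<dots> \<le> (t i - t (i - 1)) * norm (A (\<xi> i)) + C * (Flim (t i) - Flim (t (i - 1)))"
        using norm_propagator_lim_minus_one_le[of "t (i - 1)" "t i"] lt by (simp add: C_def)
      also have "\<dots> = G (\<xi> i) (t i) - G (\<xi> i) (t (i - 1))" by (simp add: G_def algebra_simps)
      finally show "T i \<le> G (\<xi> i) (t i) - G (\<xi> i) (t (i - 1))" .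
    qed
    \<comment> \<open>Many intervals may share one tag. They are grouped by tag, and each group lies
      in the small window around its tag.\<close>
    also have "\<dots> = (\<Sum>x\<in>\<xi> ` I. \<Sum>i\<in>{i \<in> I. \<xi> i = x}. G (\<xi> i) (t i) - G (\<xi> i) (t (i - 1)))"
      by (rule sum.image_gen[OF I(2)])
    also have "\<dots> \<le> (\<Sum>x\<in>\<xi> ` I. w x)"
    proof (rule sum_mono)
      fix x assume "x \<in> \<xi> ` I"
      then have x: "x \<in> D" by (auto simp: I_def)
      have "(\<Sum>i\<in>{i \<in> I. \<xi> i = x}. G (\<xi> i) (t i) - G (\<xi> i) (t (i - 1))) =
          (\<Sum>i\<in>{i \<in> I. \<xi> i = x}. G x (t i) - G x (t (i - 1)))"
        by (rule sum.cong) auto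
      also have "\<dots> \<le> G x (x + d1 x) - G x (x - d1 x)"
      proof (rule sum_mono_increments_le[OF mono_G, where m = m])
        show "x - d1 x \<le> t (i - 1) \<and> t i \<le> x + d1 x" if "i \<in> {i \<in> I. \<xi> i = x}" for i
          using that near[of i] x by (auto simp: I_def \<delta>_def intro: less_imp_le)
        show "x - d1 x \<le> x + d1 x" using d1(1)[of x] by simp
      qed (use I less in \<open>auto intro: less_imp_le\<close>)
      also have "\<dots> \<le> w x" by (rule d1(2))
      finally show "(\<Sum>i\<in>{i \<in> I. \<xi> i = x}. G (\<xi> i) (t i) - G (\<xi> i) (t (i - 1))) \<le> w x" .
    qed
    also have "\<dots> = \<epsilon> / 4 * (\<Sum>x\<in>\<xi> ` I. (1/2) ^ to_nat_on D x)"
      by (simp add: w_def sum_distrib_left)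
    also have "\<dots> \<le> \<epsilon> / 4 * 2"
      using assms I(2) inj_on_to_nat_on[OF D]
      by (intro mult_left_mono sum_half_powers_le) (auto simp: I_def elim: inj_on_subset)
    finally have sum_I: "(\<Sum>i\<in>I. T i) \<le> \<epsilon> / 2" by simp
    have "(\<Sum>i\<in>{1..m} - I. T i) \<le> (\<Sum>i\<in>{1..m} - I. e * (t i - t (i - 1)))"
    proof (rule sum_mono)
      fix i assume i: "i \<in> {1..m} - I"
      then have i1: "i \<in> {1..m}" and x: "\<xi> i \<in> {a..b} - D" using tag by (auto simp: I_def)
      have \<delta>: "\<delta> (\<xi> i) = d2 (\<xi> i)" using x by (simp add: \<delta>_def)
      obtain k where k: "{\<xi> i - d2 (\<xi> i)<..<\<xi> i + d2 (\<xi> i)} \<subseteq> {l k<..<r k}"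
        "\<And>h. 0 \<le> h \<Longrightarrow> h < 2 * d2 (\<xi> i) \<Longrightarrow> norm (1 + h *\<^sub>R A (\<xi> i) - exp (h *\<^sub>R A (l k))) \<le> e * h"
        using d2(2)[OF x] by blast
      have "t (i - 1) \<in> {l k<..<r k}" "t i \<in> {l k<..<r k}"
        by (rule subsetD[OF k(1)], use near[OF i1] less[OF i1] \<delta> in simp)+
      then have "Wlim (t i) * Qlim (t (i - 1)) = exp ((t i - t (i - 1)) *\<^sub>R A (l k))"
        by (intro propagator_lim_step) auto
      then show "T i \<le> e * (t i - t (i - 1))"
        unfolding T_def using near[OF i1] less[OF i1] \<delta> by (simp add: k(2))
    qed
    also have "\<dots> \<le> (\<Sum>i=1..m. e * (t i - t (i - 1)))"
      using e less by (intro sum_mono2) (auto intro: less_imp_le)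
    also have "\<dots> = e * (b - a)"
      using part sum_telescope_1[of t m] by (simp add: sum_distrib_left[symmetric] free_tagged_partition_def)
    also have "\<dots> = \<epsilon> / 4" using ab unfolding e_def by (intro nonzero_divide_eq_eq[THEN iffD1, symmetric]) auto
    finally have "(\<Sum>i\<in>{1..m} - I. T i) \<le> \<epsilon> / 4" .
    then have "(\<Sum>i=1..m. T i) \<le> \<epsilon> / 4 + \<epsilon> / 2"
      using sum_I sum.subset_diff[OF I(1), of T] by simp
    also have "\<dots> < \<epsilon>" using assms by simp
    finally show ?thesis by (simp add: T_def)
  qed
  moreover have "0 < \<delta> x" if "x \<in> {a..b}" for x using that d1 d2 by (auto simp: \<delta>_def)
  ultimately show ?thesis by (intro exI[of _ \<delta>]) auto
qed

lemma strongly_McShane_product_integrable_if_summable: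
  "strongly_McShane_product_integrable a b A"
proof -
  have inv: "alg_inverse (Wlim t) = Qlim t" for t
    by (rule alg_inverse_eq[OF Wlim_inverse])
  \<comment> \<open>\<open>Wlim t\<close> and \<open>Qlim t\<close> are themselves limit
    propagators, from and to \<open>a\<close>.\<close>
  have "bounded (Wlim ` {a..b})" "bounded (Qlim ` {a..b})"
    using norm_propagator_lim_le[of _ a] norm_propagator_lim_le[of a]
    by (auto simp: bounded_iff Wlim_a Qlim_a)
  moreover have "alg_invertible (Wlim t)" for t
    unfolding alg_invertible_def using Wlim_inverse by blast
  ultimately show ?thesis
    unfolding strongly_McShane_product_integrable_def using strongly_integrable_gauge
    by (intro exI[of _ Wlim]) (simp add: inv)
qed

end
end

section \<open>Summability from strong product integrability\<close>

text \<open>Serves for division points and tags alike. Entry 0 of the second sequence is dropped: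
  for points it repeats the common point at index \<open>m\<close>, and tags start at index
  1.\<close>

definition append_at :: "nat \<Rightarrow> (nat \<Rightarrow> real) \<Rightarrow> (nat \<Rightarrow> real) \<Rightarrow> nat \<Rightarrow> real" where
  "append_at m f g i = (if i \<le> m then f i else g (i - m))"

lemma sum_append:
  "(\<Sum>i=1..m + n. h i) = (\<Sum>i=1..m. h i) + (\<Sum>i=1..n. h (m + i))" for h :: "nat \<Rightarrow> real"
  by (induction n) (simp_all add: add.assoc)

lemma append_at_points:
  assumes "free_tagged_partition u w m s \<xi>" "free_tagged_partition w v n t \<zeta>" "i \<in> {1..n}"
  shows "append_at m s t (m + i) = t i" "append_at m s t (m + i - 1) = t (i - 1)"
proof -
  have "s m = t 0" using assms(1,2) by (simp add: free_tagged_partition_def)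
  then show "append_at m s t (m + i - 1) = t (i - 1)"
    using assms(3) by (cases "i = 1") (auto simp: append_at_def)
  show "append_at m s t (m + i) = t i" using assms(3) by (simp add: append_at_def)
qed

lemma free_tagged_partition_append:
  assumes 1: "free_tagged_partition u w m s \<xi>" and 2: "free_tagged_partition w v n t \<zeta>"
    and le: "u \<le> w" "w \<le> v"
  shows "free_tagged_partition u v (m + n) (append_at m s t) (append_at m \<xi> \<zeta>)"
proof -
  have "append_at m s t (i - 1) < append_at m s t i \<and> append_at m \<xi> \<zeta> i \<in> {u..v}"
    if i: "i \<in> {1..m + n}" for i
  proof (cases "i \<le> m")
    case True
    then have "s (i - 1) < s i \<and> \<xi> i \<in> {u..w}"
      using 1 i unfolding free_tagged_partition_def by auto
    then show ?thesis using True le by (auto simp: append_at_def)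
  next
    case False
    then obtain j where j: "i = m + j" "j \<in> {1..n}" using i by (intro that[of "i - m"]) auto
    then have "t (j - 1) < t j \<and> \<zeta> j \<in> {w..v}"
      using 2 unfolding free_tagged_partition_def by blast
    then show ?thesis
      using append_at_points[OF 1 2 j(2)] j le by (auto simp: append_at_def)
  qed
  moreover have "append_at m s t 0 = u" "append_at m s t (m + n) = v"
    using 1 2 by (auto simp: append_at_def free_tagged_partition_def)
  ultimately show ?thesis unfolding free_tagged_partition_def by blast
qed

lemma delta_fine_append:
  assumes 1: "free_tagged_partition u w m s \<xi>'" "free_tagged_partition w v n t \<zeta>'"
    and 2: "delta_fine \<delta> m s \<xi>" "delta_fine \<delta> n t \<zeta>"
  shows "delta_fine \<delta> (m + n) (append_at m s t) (append_at m \<xi> \<zeta>)"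
  unfolding delta_fine_def
proof
  fix i assume i: "i \<in> {1..m + n}"
  show "{append_at m s t (i - 1)..append_at m s t i} \<subseteq>
    {append_at m \<xi> \<zeta> i - \<delta> (append_at m \<xi> \<zeta> i)<..<append_at m \<xi> \<zeta> i + \<delta> (append_at m \<xi> \<zeta> i)}"
  proof (cases "i \<le> m")
    case True
    then show ?thesis using 2(1) i unfolding delta_fine_def append_at_def by auto
  next
    case False
    then obtain j where j: "i = m + j" "j \<in> {1..n}" using i by (intro that[of "i - m"]) auto
    have "append_at m \<xi> \<zeta> i = \<zeta> j" using j by (simp add: append_at_def)
    then show ?thesis
      using 2(2) append_at_points[OF 1 j(2)] j unfolding delta_fine_def by simp
  qed
qed

lemma sum_append_at:
  fixes h :: "real \<Rightarrow> real \<Rightarrow> real \<Rightarrow> real"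
  assumes "free_tagged_partition u w m s \<xi>'" "free_tagged_partition w v n t \<zeta>'"
  shows "(\<Sum>i=1..m + n. h (append_at m \<xi> \<zeta> i) (append_at m s t (i - 1)) (append_at m s t i)) =
    (\<Sum>i=1..m. h (\<xi> i) (s (i - 1)) (s i)) + (\<Sum>i=1..n. h (\<zeta> i) (t (i - 1)) (t i))"
proof -
  have "(\<Sum>i=1..m. h (append_at m \<xi> \<zeta> i) (append_at m s t (i - 1)) (append_at m s t i)) =
      (\<Sum>i=1..m. h (\<xi> i) (s (i - 1)) (s i))"
    by (rule sum.cong) (auto simp: append_at_def)
  moreover have "(\<Sum>i=1..n. h (append_at m \<xi> \<zeta> (m + i)) (append_at m s t (m + i - 1)) (append_at m s t (m + i))) =
      (\<Sum>i=1..n. h (\<zeta> i) (t (i - 1)) (t i))"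
  proof (rule sum.cong)
    fix i assume i: "i \<in> {1..n}"
    then have "append_at m \<xi> \<zeta> (m + i) = \<zeta> i" by (simp add: append_at_def)
    then show "h (append_at m \<xi> \<zeta> (m + i)) (append_at m s t (m + i - 1)) (append_at m s t (m + i)) =
        h (\<zeta> i) (t (i - 1)) (t i)"
      by (simp only: append_at_points[OF assms i])
  qed simp
  ultimately show ?thesis by (simp only: sum_append)
qed

text \<open>Cousin's lemma by Bolzano's principle: fine partitions can be concatenated, and a short
  interval around \<open>x\<close> needs only the tag \<open>x\<close>. Tags are kept inside their
  intervals because the comparison with the gauge integral requires it.\<close>

lemma fine_partition_exists:
  assumes "u \<le> v" "\<And>x. x \<in> {u..v} \<Longrightarrow> 0 < \<delta> x"
  shows "\<exists>m t \<xi>. free_tagged_partition u v m t \<xi> \<and> delta_fine \<delta> m t \<xi> \<and>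
    (\<forall>i\<in>{1..m}. \<xi> i \<in> {t (i - 1)..t i})"
proof -
  define P where "P p q \<longleftrightarrow> (u \<le> p \<and> p \<le> q \<and> q \<le> v \<longrightarrow>
    (\<exists>m t \<xi>. free_tagged_partition p q m t \<xi> \<and> delta_fine \<delta> m t \<xi> \<and>
      (\<forall>i\<in>{1..m}. \<xi> i \<in> {t (i - 1)..t i})))" for p q
  have "P u v"
    using assms(1)
  proof (induction rule: Bolzano)
    case (trans p q r)
    show ?case unfolding P_def
    proof
      assume "u \<le> p \<and> p \<le> r \<and> r \<le> v"
      then have le: "u \<le> p \<and> p \<le> q \<and> q \<le> v" "u \<le> q \<and> q \<le> r \<and> r \<le> v"
        using trans(3,4) by auto
      obtain m s \<xi> where m: "free_tagged_partition p q m s \<xi>" "delta_fine \<delta> m s \<xi>"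
        "\<forall>i\<in>{1..m}. \<xi> i \<in> {s (i - 1)..s i}"
        using trans(1) le(1) unfolding P_def by blast
      obtain n t \<zeta> where n: "free_tagged_partition q r n t \<zeta>" "delta_fine \<delta> n t \<zeta>"
        "\<forall>i\<in>{1..n}. \<zeta> i \<in> {t (i - 1)..t i}"
        using trans(2) le(2) unfolding P_def by blast
      note 1 = m(1) n(1) and 2 = m(2) n(2) and 3 = m(3) n(3)
      have "append_at m \<xi> \<zeta> i \<in> {append_at m s t (i - 1)..append_at m s t i}"
        if i: "i \<in> {1..m + n}" for i
      proof (cases "i \<le> m")
        case True
        then show ?thesis using 3(1) i by (auto simp: append_at_def)
      next
        case False
        then obtain j where j: "i = m + j" "j \<in> {1..n}" using i by (intro that[of "i - m"]) auto
        then show ?thesis using append_at_points[OF 1 j(2)] 3(2) by (simp add: append_at_def)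
      qed
      then show "\<exists>m t \<xi>. free_tagged_partition p r m t \<xi> \<and> delta_fine \<delta> m t \<xi> \<and>
          (\<forall>i\<in>{1..m}. \<xi> i \<in> {t (i - 1)..t i})"
        using free_tagged_partition_append[OF 1 trans(3,4)] delta_fine_append[OF 1 2] by blast
    qed
  next
    case (local x)
    have "P p q" if pq: "p \<le> x \<and> x \<le> q \<and> q - p < \<delta> x" for p q
    proof (cases "p = q")
      case True
      \<comment> \<open>Intervals of a partition have positive length, so \<open>p = q\<close> gets
        the empty partition.\<close>
      then show ?thesis unfolding P_def
        by (intro impI exI[of _ 0] exI[of _ "\<lambda>_. p"])
          (auto simp: free_tagged_partition_def delta_fine_def)
    next
      case False
      then show ?thesis unfolding P_def using pq
        by (intro impI exI[of _ "1::nat"] exI[of _ "\<lambda>i. if i = 0 then p else q"] exI[of _ "\<lambda>_. x"])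
          (auto simp: free_tagged_partition_def delta_fine_def)
    qed
    then show ?case using assms(2)[of x] local by auto
  qed
  then show ?thesis using assms(1) by (simp add: P_def)
qed

text \<open>Connects partitions given by sequences with the tagged divisions of the gauge integral;
  injectivity turns sums over the division into sums over indices.\<close>

lemma tagged_division_of_partition:
  assumes "u < v" and part: "free_tagged_partition u v m t \<xi>" and tag: "\<forall>i\<in>{1..m}. \<xi> i \<in> {t (i - 1)..t i}"
  shows "(\<lambda>i. (\<xi> i, {t (i - 1)..t i})) ` {1..m} tagged_division_of {u..v}" (is "?D tagged_division_of _")
    and "inj_on (\<lambda>i. (\<xi> i, {t (i - 1)..t i})) {1..m}"
proof -
  have less: "t (i - 1) < t i" if "i \<in> {1..m}" for i
    using part that unfolding free_tagged_partition_def by blast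
  have ends: "t 0 = u" "t m = v" using part by (auto simp: free_tagged_partition_def)
  have sep: "t i \<le> t (j - 1)" if "i \<in> {1..m}" "j \<in> {1..m}" "i < j" for i j
    using free_tagged_partition_mono[OF part, of i "j - 1"] that by auto
  have ne: "{t (i - 1)<..<t i} \<inter> {t (j - 1)<..<t j} = {}" if "i \<in> {1..m}" "j \<in> {1..m}" "i \<noteq> j" for i j
    using sep[of i j] sep[of j i] that by (cases "i < j") auto
  show "inj_on (\<lambda>i. (\<xi> i, {t (i - 1)..t i})) {1..m}"
  proof (rule inj_onI)
    fix i j assume ij: "i \<in> {1..m}" "j \<in> {1..m}" "(\<xi> i, {t (i - 1)..t i}) = (\<xi> j, {t (j - 1)..t j})"
    then have "t (i - 1) = t (j - 1)" "t i = t j" using less[of i] by (auto simp: Icc_eq_Icc)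
    then show "i = j" using ne[OF ij(1,2)] less[OF ij(1)] dense[OF less[OF ij(1)]] by fastforce
  qed
  show "?D tagged_division_of {u..v}"
  proof (rule tagged_division_ofI)
    show "finite ?D" by simp
    fix x K assume "(x, K) \<in> ?D"
    then obtain i where i: "i \<in> {1..m}" "x = \<xi> i" "K = {t (i - 1)..t i}" by auto
    show "x \<in> K" using i tag by simp
    show "K \<subseteq> {u..v}"
      using i free_tagged_partition_mono[OF part, of 0 "i - 1"] free_tagged_partition_mono[OF part, of i m] ends
      by auto
    show "\<exists>a b. K = cbox a b" using i by (metis box_real(2))
    fix x' K' assume "(x', K') \<in> ?D" "(x, K) \<noteq> (x', K')"
    then obtain j where "j \<in> {1..m}" "x' = \<xi> j" "K' = {t (j - 1)..t j}" by blast
    moreover from this have "i \<noteq> j" using \<open>(x, K) \<noteq> (x', K')\<close> i by auto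
    ultimately have j: "j \<in> {1..m}" "K' = {t (j - 1)..t j}" "i \<noteq> j" by auto
    then show "interior K \<inter> interior K' = {}" using ne[OF i(1) j(1,3)] i by simp
  next
    show "\<Union>{K. \<exists>x. (x, K) \<in> ?D} = {u..v}"
    proof -
      have *: "\<exists>i\<in>{1..Suc n}. y \<in> {t (i - 1)..t i}" if "t 0 \<le> y" "y \<le> t (Suc n)" for y n
        using that
      proof (induction n)
        case 0
        then show ?case by simp
      next
        case (Suc n)
        show ?case
        proof (cases "y \<le> t (Suc n)")
          case True
          then show ?thesis using Suc.IH[OF Suc.prems(1)] by force
        next
          case False
          then show ?thesis using Suc.prems by (intro bexI[of _ "Suc (Suc n)"]) auto
        qed
      qed
      obtain n where n: "m = Suc n" using ends \<open>u < v\<close> by (cases m) auto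
      have "{u..v} \<subseteq> \<Union>{K. \<exists>x. (x, K) \<in> ?D}"
      proof
        fix y assume "y \<in> {u..v}"
        then obtain i where "i \<in> {1..m}" "y \<in> {t (i - 1)..t i}" using *[of y n] ends n by auto
        then show "y \<in> \<Union>{K. \<exists>x. (x, K) \<in> ?D}" by blast
      qed
      moreover have "{t (i - 1)..t i} \<subseteq> {u..v}" if "i \<in> {1..m}" for i
        using that free_tagged_partition_mono[OF part, of 0 "i - 1"] free_tagged_partition_mono[OF part, of i m] ends
        by auto
      then have "\<Union>{K. \<exists>x. (x, K) \<in> ?D} \<subseteq> {u..v}" by blast
      ultimately show ?thesis by (rule antisym[rotated])
    qed
  qed
qed

section \<open>Integrals of truncations and their uniform bound\<close>

context step_partition
begin

lemma norm_partial_eq: "norm (partial n t) = (\<Sum>k<n. norm (A (l k)) * indicator {l k..<r k} t)"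
proof (cases "\<exists>k<n. l k \<le> t \<and> t < r k")
  case True
  then obtain k where k: "k < n" "l k \<le> t" "t < r k" by blast
  have "(\<Sum>j<n. norm (A (l j)) * indicator {l j..<r j} t) = (\<Sum>j\<in>{k}. norm (A (l j)) * indicator {l j..<r j} t)"
  proof (rule sum.mono_neutral_right)
    have "t \<notin> {l j..<r j}" if "j \<noteq> k" for j
      using step_unique[OF k(2,3), of j] that by auto
    then show "\<forall>j\<in>{..<n} - {k}. norm (A (l j)) * indicator {l j..<r j} t = 0" by simp
  qed (use k in auto)
  then show ?thesis using True k const[OF k(2,3)] by (simp add: partial_def)
next
  case False
  then have "(\<Sum>j<n. norm (A (l j)) * indicator {l j..<r j} t) = 0"
    by (intro sum.neutral) (auto simp: indicator_def)
  then show ?thesis unfolding partial_def if_not_P[OF False] by simp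
qed

lemma norm_partial_le: "norm (partial n t) \<le> norm (A t)"
  by (simp add: partial_def)

lemma has_integral_norm_partial:
  "((\<lambda>t. norm (partial n t)) has_integral (\<Sum>k<n. mass k)) {a..b}"
  unfolding norm_partial_eq
proof (rule has_integral_sum)
  fix k
  have "((\<lambda>t. norm (A (l k))) has_integral mass k) {l k..r k}"
    using has_integral_const_real[of "norm (A (l k))" "l k" "r k"] lr[of k] by (simp add: mass_def)
  then have "((\<lambda>t. if t \<in> {l k..r k} then norm (A (l k)) else 0) has_integral mass k) {a..b}"
    using al[of k] rb[of k] by (subst has_integral_restrict) auto
  then show "((\<lambda>t. norm (A (l k)) * indicator {l k..<r k} t) has_integral mass k) {a..b}"
    by (rule has_integral_spike[where S = "{r k}", rotated 2]) (auto simp: indicator_def)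
qed simp

lemma integrable_norm_partial:
  assumes "a \<le> u" "v \<le> b"
  shows "(\<lambda>t. norm (partial n t)) integrable_on {u..v}"
  using integrable_subinterval_real[OF has_integral_integrable[OF has_integral_norm_partial]] assms by auto

text \<open>
  Tags are free, so close to \<open>x\<close> every interval of a fine partition may be retagged with \<open>x\<close>, and
  comparing both tags through \<open>Y\<close> bounds the integral of \<open>norm (partial n t)\<close> near \<open>x\<close> uniformly in
  \<open>n\<close>. Bolzano's principle passes from local bounds to a bound on \<open>{a..b}\<close>.
\<close>

lemma summable_mass_if_gauge:
  assumes \<delta>: "\<And>x. x \<in> {a..b} \<Longrightarrow> 0 < \<delta> x"
    and small: "\<And>m t \<xi>. free_tagged_partition a b m t \<xi> \<Longrightarrow> delta_fine \<delta> m t \<xi> \<Longrightarrow>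
      (\<Sum>i=1..m. norm ((t i - t (i - 1)) *\<^sub>R A (\<xi> i) - Y (t (i - 1)) (t i))) < 1"
  shows "summable mass"
proof -
  define h where "h x p q = norm ((q - p) *\<^sub>R A x - Y p q)" for x p q
  \<comment> \<open>A fine partition of a subinterval is extended to \<open>[a, b]\<close> by fine
    partitions on both sides; the terms added are nonnegative.\<close>
  have sub: "(\<Sum>i=1..m. h (\<xi> i) (t (i - 1)) (t i)) < 1"
    if uv: "a \<le> u" "u \<le> v" "v \<le> b" and part: "free_tagged_partition u v m t \<xi>" and fine: "delta_fine \<delta> m t \<xi>"
    for u v m t \<xi>
  proof -
    obtain m1 t1 \<xi>1 where 1: "free_tagged_partition a u m1 t1 \<xi>1" "delta_fine \<delta> m1 t1 \<xi>1"
      using fine_partition_exists[of a u \<delta>] \<delta> uv by auto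
    obtain m3 t3 \<xi>3 where 3: "free_tagged_partition v b m3 t3 \<xi>3" "delta_fine \<delta> m3 t3 \<xi>3"
      using fine_partition_exists[of v b \<delta>] \<delta> uv by auto
    note part12 = free_tagged_partition_append[OF 1(1) part uv(1,2)]
    note fine12 = delta_fine_append[OF 1(1) part 1(2) fine]
    have "a \<le> v" using uv by simp
    note part123 = free_tagged_partition_append[OF part12 3(1) \<open>a \<le> v\<close> uv(3)]
    note fine123 = delta_fine_append[OF part12 3(1) fine12 3(2)]
    have "(\<Sum>i=1..m1. h (\<xi>1 i) (t1 (i - 1)) (t1 i)) + (\<Sum>i=1..m. h (\<xi> i) (t (i - 1)) (t i)) +
        (\<Sum>i=1..m3. h (\<xi>3 i) (t3 (i - 1)) (t3 i)) < 1"
      using small[OF part123 fine123, folded h_def]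
      unfolding sum_append_at[OF part12 3(1)] sum_append_at[OF 1(1) part] .
    moreover have "0 \<le> (\<Sum>i=1..m1. h (\<xi>1 i) (t1 (i - 1)) (t1 i))" "0 \<le> (\<Sum>i=1..m3. h (\<xi>3 i) (t3 (i - 1)) (t3 i))"
      by (auto intro!: sum_nonneg simp: h_def)
    ultimately show ?thesis by linarith
  qed
  \<comment> \<open>Of the constant 3, one unit is the error of a Riemann sum for the integral, and
    the sums with the tags \<xi> and with the single tag \<open>x\<close> take one unit
    each.\<close>
  have near: "integral {u..v} (\<lambda>t. norm (partial n t)) \<le> 3 + norm (A x) * (b - a)"
    if uv: "a \<le> u" "u < v" "v \<le> b" and x: "u \<le> x" "x \<le> v" "v - u < \<delta> x" for u v x n
  proof -
    let ?J = "integral {u..v} (\<lambda>t. norm (partial n t))"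
    have "((\<lambda>t. norm (partial n t)) has_integral ?J) {u..v}"
      using integrable_norm_partial uv by (intro integrable_integral) auto
    then obtain \<gamma> where \<gamma>: "gauge \<gamma>"
      "\<And>D. D tagged_division_of {u..v} \<Longrightarrow> \<gamma> fine D \<Longrightarrow>
        norm ((\<Sum>(x, k)\<in>D. measure lborel k *\<^sub>R norm (partial n x)) - ?J) < 1"
      unfolding has_integral_real by (metis zero_less_one)
    have "\<exists>\<rho>>0. ball y \<rho> \<subseteq> \<gamma> y" for y
      using \<gamma>(1) unfolding gauge_def by (meson open_contains_ball)
    then obtain \<rho> where \<rho>: "\<And>y. \<rho> y > 0" "\<And>y. ball y (\<rho> y) \<subseteq> \<gamma> y" by metis
    \<comment> \<open>The same partition has to be fine for \<delta> and for the gauge \<gamma> of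
      the integral.\<close>
    define \<delta>' where "\<delta>' y = min (\<delta> y) (\<rho> y)" for y
    have "0 < \<delta>' y" if "y \<in> {u..v}" for y using \<delta>[of y] \<rho>(1)[of y] that uv by (auto simp: \<delta>'_def)
    then obtain m t \<xi> where part: "free_tagged_partition u v m t \<xi>" and fine': "delta_fine \<delta>' m t \<xi>"
      and tag: "\<forall>i\<in>{1..m}. \<xi> i \<in> {t (i - 1)..t i}"
      using fine_partition_exists[of u v \<delta>'] uv by auto
    have fine: "delta_fine \<delta> m t \<xi>"
      using fine' unfolding delta_fine_def \<delta>'_def by fastforce
    have less: "t (i - 1) < t i" if "i \<in> {1..m}" for i
      using part that unfolding free_tagged_partition_def by blast
    have in_uv: "{t (i - 1)..t i} \<subseteq> {u..v}" if "i \<in> {1..m}" for i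
      using that part free_tagged_partition_mono[OF part, of 0 "i - 1"] free_tagged_partition_mono[OF part, of i m]
      by (auto simp: free_tagged_partition_def)
    define D where "D = (\<lambda>i. (\<xi> i, {t (i - 1)..t i})) ` {1..m}"
    have "\<gamma> fine D"
    proof (rule fineI)
      fix y K assume "(y, K) \<in> D"
      then obtain i where i: "i \<in> {1..m}" "y = \<xi> i" "K = {t (i - 1)..t i}" by (auto simp: D_def)
      then have "K \<subseteq> {y - \<delta>' y<..<y + \<delta>' y}" using fine' unfolding delta_fine_def by blast
      also have "\<dots> \<subseteq> ball y (\<rho> y)" by (auto simp: ball_eq_greaterThanLessThan \<delta>'_def)
      also have "\<dots> \<subseteq> \<gamma> y" by (rule \<rho>(2))
      finally show "K \<subseteq> \<gamma> y" .
    qed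
    moreover have "(\<Sum>(x, k)\<in>D. measure lborel k *\<^sub>R norm (partial n x)) = (\<Sum>i=1..m. (t i - t (i - 1)) * norm (partial n (\<xi> i)))"
      unfolding D_def using tagged_division_of_partition(2)[OF uv(2) part tag] less
      by (subst sum.reindex) (auto intro!: sum.cong simp: less_imp_le)
    ultimately have "?J \<le> (\<Sum>i=1..m. (t i - t (i - 1)) * norm (partial n (\<xi> i))) + 1"
      using \<gamma>(2)[of D] tagged_division_of_partition(1)[OF uv(2) part tag] by (simp add: D_def abs_less_iff)
    \<comment> \<open>The terms with tags \<open>\<xi> i\<close> and \<open>x\<close> are compared
      with the same value of \<open>Y\<close>, so replacing one tag by the other costs only the two
      errors.\<close>
    also have "(\<Sum>i=1..m. (t i - t (i - 1)) * norm (partial n (\<xi> i))) \<le>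
        (\<Sum>i=1..m. h (\<xi> i) (t (i - 1)) (t i) + h x (t (i - 1)) (t i) + norm (A x) * (t i - t (i - 1)))"
    proof (rule sum_mono)
      fix i assume i: "i \<in> {1..m}"
      let ?d = "t i - t (i - 1)" and ?Y = "Y (t (i - 1)) (t i)"
      have "?d * norm (partial n (\<xi> i)) \<le> norm (?d *\<^sub>R A (\<xi> i))"
        using norm_partial_le[of n "\<xi> i"] less[OF i] by simp
      also have "\<dots> \<le> norm (?d *\<^sub>R A (\<xi> i) - ?Y) + norm (?d *\<^sub>R A x - ?Y) + norm (?d *\<^sub>R A x)"
        using norm_triangle_ineq[of "?d *\<^sub>R A (\<xi> i) - ?Y" "?Y"] norm_triangle_ineq4[of "?d *\<^sub>R A x" "?d *\<^sub>R A x - ?Y"]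
        by simp
      finally show "?d * norm (partial n (\<xi> i)) \<le>
          h (\<xi> i) (t (i - 1)) (t i) + h x (t (i - 1)) (t i) + norm (A x) * ?d"
        using less[OF i] by (simp add: h_def mult.commute)
    qed
    also have "\<dots> = (\<Sum>i=1..m. h (\<xi> i) (t (i - 1)) (t i)) + (\<Sum>i=1..m. h x (t (i - 1)) (t i)) +
        norm (A x) * (v - u)"
      using sum_telescope_1[of t m] part
      by (simp add: sum.distrib sum_distrib_left[symmetric] free_tagged_partition_def)
    finally have "?J \<le> (\<Sum>i=1..m. h (\<xi> i) (t (i - 1)) (t i)) + (\<Sum>i=1..m. h x (t (i - 1)) (t i)) +
        norm (A x) * (v - u) + 1" by simp
    moreover have "(\<Sum>i=1..m. h (\<xi> i) (t (i - 1)) (t i)) < 1"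
      by (rule sub[OF uv(1) less_imp_le[OF uv(2)] uv(3) part fine])
    moreover have "(\<Sum>i=1..m. h x (t (i - 1)) (t i)) < 1"
    proof (rule sub[OF uv(1) less_imp_le[OF uv(2)] uv(3), where \<xi> = "\<lambda>_. x"])
      show "free_tagged_partition u v m t (\<lambda>_. x)"
        using part x unfolding free_tagged_partition_def by auto
      have "{u..v} \<subseteq> {x - \<delta> x<..<x + \<delta> x}" using x by auto
      then show "delta_fine \<delta> m t (\<lambda>_. x)" unfolding delta_fine_def using in_uv by blast
    qed
    moreover have "norm (A x) * (v - u) \<le> norm (A x) * (b - a)"
      using uv by (intro mult_left_mono) auto
    ultimately show ?thesis by linarith
  qed
  \<comment> \<open>The order of quantifiers matters: \<open>C\<close> is chosen before
    \<open>n\<close>, whereas a bound for each \<open>n\<close> alone would be trivial.\<close>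
  define P where "P u v \<longleftrightarrow> (a \<le> u \<and> u \<le> v \<and> v \<le> b \<longrightarrow>
    (\<exists>C. \<forall>n. integral {u..v} (\<lambda>t. norm (partial n t)) \<le> C))" for u v
  have "P a b"
    using less_imp_le[OF ab]
  proof (induction rule: Bolzano)
    case (trans u w v)
    show ?case unfolding P_def
    proof
      assume uv: "a \<le> u \<and> u \<le> v \<and> v \<le> b"
      then obtain C C' where C: "\<And>n. integral {u..w} (\<lambda>t. norm (partial n t)) \<le> C"
        "\<And>n. integral {w..v} (\<lambda>t. norm (partial n t)) \<le> C'"
        using trans unfolding P_def by (meson order_trans)
      have "integral {u..v} (\<lambda>t. norm (partial n t)) \<le> C + C'" for n
        using Henstock_Kurzweil_Integration.integral_combine[OF trans(3,4) integrable_norm_partial, of n] C[of n] uv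
        by simp
      then show "\<exists>C. \<forall>n. integral {u..v} (\<lambda>t. norm (partial n t)) \<le> C" by blast
    qed
  next
    case (local x)
    have "P u v" if "u \<le> x \<and> x \<le> v \<and> v - u < \<delta> x" for u v
    proof (cases "u = v")
      case True
      then show ?thesis unfolding P_def by (intro impI exI[of _ 0]) simp
    next
      case False
      then show ?thesis using near[of u v x] that unfolding P_def
        by (intro impI exI[of _ "3 + norm (A x) * (b - a)"]) auto
    qed
    then show ?case using \<delta>[of x] local by auto
  qed
  then obtain C where C: "\<And>n. integral {a..b} (\<lambda>t. norm (partial n t)) \<le> C"
    using ab by (auto simp: P_def)
  then have "(\<Sum>k<n. mass k) \<le> C" for n
    using integral_unique[OF has_integral_norm_partial, of n] by metis
  then show "summable mass" by (rule summableI_nonneg_bounded[OF mass_nonneg])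
qed

end

theorem (in step_partition_algebra) strongly_McShane_product_integrable_iff:
  "strongly_McShane_product_integrable a b A \<longleftrightarrow> summable mass"
proof
  assume "strongly_McShane_product_integrable a b A"
  then obtain V where "\<forall>\<epsilon>>0. \<exists>\<delta>. (\<forall>x\<in>{a..b}. 0 < \<delta> x) \<and>
      (\<forall>m t \<xi>. free_tagged_partition a b m t \<xi> \<and> delta_fine \<delta> m t \<xi> \<longrightarrow>
        (\<Sum>i=1..m. norm (1 + (t i - t (i - 1)) *\<^sub>R A (\<xi> i) - V (t i) * alg_inverse (V (t (i - 1))))) < \<epsilon>)"
    unfolding strongly_McShane_product_integrable_def by blast
  from this[rule_format, OF zero_less_one] obtain \<delta> where \<delta>: "\<forall>x\<in>{a..b}. 0 < \<delta> x"
    and small: "\<forall>m t \<xi>. free_tagged_partition a b m t \<xi> \<and> delta_fine \<delta> m t \<xi> \<longrightarrow>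
      (\<Sum>i=1..m. norm (1 + (t i - t (i - 1)) *\<^sub>R A (\<xi> i) - V (t i) * alg_inverse (V (t (i - 1))))) < 1"
    by blast
  \<comment> \<open>The unit is moved into \<open>Y\<close>, so that the error compares a Riemann
    term with a quantity that does not depend on the tag.\<close>
  define Y where "Y p q = V q * alg_inverse (V p) - 1" for p q
  have Y: "norm (d *\<^sub>R x - Y p q) = norm (1 + d *\<^sub>R x - V q * alg_inverse (V p))" for d x p q
    by (simp add: Y_def algebra_simps)
  show "summable mass"
  proof (rule summable_mass_if_gauge)
    show "0 < \<delta> x" if "x \<in> {a..b}" for x using \<delta> that by blast
    show "(\<Sum>i=1..m. norm ((t i - t (i - 1)) *\<^sub>R A (\<xi> i) - Y (t (i - 1)) (t i))) < 1"
      if "free_tagged_partition a b m t \<xi>" "delta_fine \<delta> m t \<xi>" for m t \<xi>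
      unfolding Y using small that by blast
  qed
qed (rule strongly_McShane_product_integrable_if_summable)

section \<open>Well-ordered steps\<close>

text \<open>The intervals from an element to its successor are disjoint, and each contains a
  rational number.\<close>

lemma countable_if_successors:
  fixes S :: "real \<Rightarrow> real"
  assumes "\<And>\<alpha>. \<alpha> \<in> X \<Longrightarrow> \<alpha> < S \<alpha>" "\<And>\<alpha> \<beta>. \<alpha> \<in> X \<Longrightarrow> \<beta> \<in> X \<Longrightarrow> \<alpha> < \<beta> \<Longrightarrow> S \<alpha> \<le> \<beta>"
  shows "countable X"
proof -
  have "\<forall>\<alpha>\<in>X. \<exists>q. q \<in> \<rat> \<and> \<alpha> < q \<and> q < S \<alpha>" using Rats_dense_in_real assms(1) by blast
  then obtain q where q: "\<And>\<alpha>. \<alpha> \<in> X \<Longrightarrow> q \<alpha> \<in> \<rat>" "\<And>\<alpha>. \<alpha> \<in> X \<Longrightarrow> \<alpha> < q \<alpha> \<and> q \<alpha> < S \<alpha>"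
    by metis
  have "inj_on q X"
  proof (rule linorder_inj_onI')
    fix \<alpha> \<beta> assume "\<alpha> \<in> X" "\<beta> \<in> X" "\<alpha> < \<beta>"
    then show "q \<alpha> \<noteq> q \<beta>" using q(2)[of \<alpha>] q(2)[of \<beta>] assms(2)[of \<alpha> \<beta>] by linarith
  qed
  moreover have "countable (q ` X)" by (rule countable_subset[OF _ countable_rat]) (use q(1) in auto)
  ultimately show ?thesis by (rule countable_image_inj_on[rotated])
qed

locale step_function =
  fixes a b :: real and \<Lambda> :: "real set" and z A :: "real \<Rightarrow> 'e::{real_normed_algebra_1, banach}"
  assumes ab: "a < b" and sub: "\<Lambda> \<subseteq> {a..b}" and wo: "well_ordered_set \<Lambda>"
    and aL: "a \<in> \<Lambda>" and bL: "b \<in> \<Lambda>" and step: "is_step_function \<Lambda> a b z A"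
begin

abbreviation S where "S \<equiv> succ_in \<Lambda>"

text \<open>\<beta> may be any real number below \<open>b\<close>, since the step containing an
  arbitrary \<open>t\<close> is found through its right endpoint \<open>S t\<close>.\<close>

lemma succ_in_is_succ:
  assumes "\<beta> < b"
  shows "is_succ \<Lambda> \<beta> (S \<beta>)"
proof -
  obtain m where m: "m \<in> {\<delta> \<in> \<Lambda>. \<beta> < \<delta>}" "\<And>y. y \<in> {\<delta> \<in> \<Lambda>. \<beta> < \<delta>} \<Longrightarrow> m \<le> y"
    using well_ordered_set_least[OF wo, of "{\<delta> \<in> \<Lambda>. \<beta> < \<delta>}"] assms bL by blast
  then have "is_succ \<Lambda> \<beta> m" by (auto simp: is_succ_def)
  moreover have "\<gamma> = m" if "is_succ \<Lambda> \<beta> \<gamma>" for \<gamma>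
    using that m by (force simp: is_succ_def)
  ultimately show ?thesis unfolding succ_in_def by (rule theI)
qed

lemma succ_in:
  assumes "\<beta> < b"
  shows "S \<beta> \<in> \<Lambda>" "\<beta> < S \<beta>" "\<And>\<delta>. \<delta> \<in> \<Lambda> \<Longrightarrow> \<beta> < \<delta> \<Longrightarrow> S \<beta> \<le> \<delta>"
  using succ_in_is_succ[OF assms] by (auto simp: is_succ_def)

lemma in_interval: "\<alpha> \<in> \<Lambda> \<Longrightarrow> a \<le> \<alpha> \<and> \<alpha> \<le> b"
  using sub by auto

text \<open>
  Indexing the steps by their right endpoints makes the gaps, on which \<open>A\<close> vanishes, ordinary
  steps: the gaps are the intervals \<open>{left \<beta>..<\<beta>}\<close> for limit elements \<open>\<beta>\<close>.
\<close>

definition left :: "real \<Rightarrow> real" where "left \<beta> = Sup (below \<Lambda> \<beta>)"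

definition K :: "real set" where "K = \<Lambda> - {a}"

lemma left_bounds:
  assumes "\<beta> \<in> K"
  shows "a \<le> left \<beta>" "left \<beta> \<le> \<beta>" "\<alpha> \<in> \<Lambda> \<Longrightarrow> \<alpha> < \<beta> \<Longrightarrow> \<alpha> \<le> left \<beta>"
proof -
  have a: "a \<in> below \<Lambda> \<beta>" using assms in_interval[of \<beta>] aL by (auto simp: K_def below_def)
  have bdd: "bdd_above (below \<Lambda> \<beta>)" by (rule bdd_aboveI[of _ \<beta>]) (auto simp: below_def)
  show "a \<le> left \<beta>" unfolding left_def by (rule cSup_upper[OF a bdd])
  show "left \<beta> \<le> \<beta>" unfolding left_def by (rule cSup_least) (use a in \<open>auto simp: below_def\<close>)
  show "\<alpha> \<le> left \<beta>" if "\<alpha> \<in> \<Lambda>" "\<alpha> < \<beta>"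
    unfolding left_def using that by (intro cSup_upper bdd) (auto simp: below_def)
qed

lemma left_S:
  assumes "\<alpha> \<in> below \<Lambda> b"
  shows "left (S \<alpha>) = \<alpha>" "S \<alpha> \<in> K"
proof -
  have \<alpha>: "\<alpha> \<in> \<Lambda>" "\<alpha> < b" using assms by (auto simp: below_def)
  have "x \<le> \<alpha>" if "x \<in> below \<Lambda> (S \<alpha>)" for x
    using succ_in(3)[OF \<alpha>(2), of x] that by (force simp: below_def)
  then show "left (S \<alpha>) = \<alpha>"
    unfolding left_def using \<alpha> succ_in(2)[OF \<alpha>(2)] by (intro cSup_eq_maximum) (auto simp: below_def)
  show "S \<alpha> \<in> K" using succ_in[OF \<alpha>(2)] in_interval[OF \<alpha>(1)] by (auto simp: K_def)
qed

lemma A_eq: "\<alpha> \<in> below \<Lambda> b \<Longrightarrow> \<alpha> \<le> t \<Longrightarrow> t < S \<alpha> \<Longrightarrow> A t = z \<alpha>"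
  using step by (auto simp: is_step_function_def)

text \<open>A step \<open>[\<alpha>, S \<alpha>)\<close> containing \<open>t\<close> would have
  \<open>S \<alpha> \<le> \<beta>\<close>; as \<beta> is not a successor,
  \<open>S \<alpha> < \<beta>\<close>, hence \<open>S \<alpha> \<le> left \<beta> \<le> t\<close>, a
  contradiction.\<close>

lemma A_gap:
  assumes "\<beta> \<in> K" "\<beta> \<notin> S ` below \<Lambda> b" "left \<beta> \<le> t" "t < \<beta>"
  shows "A t = 0"
proof -
  have "\<beta> \<le> b" using assms(1) in_interval by (auto simp: K_def)
  moreover have "t \<notin> {\<alpha>..<S \<alpha>}" if \<alpha>: "\<alpha> \<in> below \<Lambda> b" for \<alpha>
  proof
    assume t: "t \<in> {\<alpha>..<S \<alpha>}"
    have \<alpha>': "\<alpha> \<in> \<Lambda>" "\<alpha> < b" using \<alpha> by (auto simp: below_def)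
    have "S \<alpha> \<le> \<beta>" using succ_in(3)[OF \<alpha>'(2), of \<beta>] t assms by (auto simp: K_def)
    then have "S \<alpha> < \<beta>" using assms(2) \<alpha> by (metis image_eqI order_less_le)
    then have "S \<alpha> \<le> left \<beta>" using left_bounds(3)[OF assms(1)] succ_in(1)[OF \<alpha>'(2)] by blast
    then show False using t assms(3) by simp
  qed
  moreover have "a \<le> t" using left_bounds(1)[OF assms(1)] assms(3) by simp
  ultimately show ?thesis using step assms(4) unfolding is_step_function_def by auto
qed

lemma A_const:
  assumes "\<beta> \<in> K" "left \<beta> \<le> t" "t < \<beta>"
  shows "A t = A (left \<beta>)"
proof (cases "\<beta> \<in> S ` below \<Lambda> b")
  case True
  then obtain \<alpha> where "\<alpha> \<in> below \<Lambda> b" "\<beta> = S \<alpha>" by blast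
  then show ?thesis using A_eq[of \<alpha> t] A_eq[of \<alpha> \<alpha>] assms left_S[of \<alpha>] by simp
next
  case False
  then show ?thesis using A_gap[OF assms(1) False, of t] A_gap[OF assms(1) False, of "left \<beta>"] assms by simp
qed

section \<open>Enumeration of the steps by natural numbers\<close>

lemma countable_K: "countable K"
proof -
  have "countable (below \<Lambda> b)"
    by (rule countable_if_successors[of _ S]) (use succ_in in \<open>auto simp: below_def\<close>)
  then have "countable (insert b (below \<Lambda> b))" by simp
  then show ?thesis by (rule countable_subset[rotated]) (use in_interval in \<open>force simp: K_def below_def\<close>)
qed

definition idx :: "nat set" where "idx = to_nat_on K ` K"
text \<open>If \<open>K\<close> is finite, the numbers outside \<open>idx\<close> carry the empty
  step at \<open>a\<close>, which lies to the left of all other steps.\<close>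

definition lpt :: "nat \<Rightarrow> real" where "lpt k = (if k \<in> idx then left (from_nat_into K k) else a)"
definition rpt :: "nat \<Rightarrow> real" where "rpt k = (if k \<in> idx then from_nat_into K k else a)"

lemma idx_K: "k \<in> idx \<Longrightarrow> from_nat_into K k \<in> K"
  by (auto simp: idx_def countable_K)

sublocale step_partition_algebra a b lpt rpt A
proof
  show "a < b" by (rule ab)
  show "lpt k \<le> rpt k" "a \<le> lpt k" "rpt k \<le> b" for k
    using left_bounds[OF idx_K] in_interval idx_K[of k] ab by (auto simp: lpt_def rpt_def K_def)
  show "rpt i \<le> lpt j \<or> rpt j \<le> lpt i" if "i \<noteq> j" for i j
  proof (cases "i \<in> idx \<and> j \<in> idx")
    case True
    define \<beta> \<gamma> where "\<beta> = from_nat_into K i" and "\<gamma> = from_nat_into K j"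
    have K: "\<beta> \<in> K" "\<gamma> \<in> K" using True idx_K by (auto simp: \<beta>_def \<gamma>_def)
    have "to_nat_on K \<beta> = i" "to_nat_on K \<gamma> = j"
      using True by (auto simp: \<beta>_def \<gamma>_def idx_def countable_K)
    then have "\<beta> \<noteq> \<gamma>" using that by auto
    then have "\<beta> \<le> left \<gamma> \<or> \<gamma> \<le> left \<beta>"
      using left_bounds(3)[OF K(1), of \<gamma>] left_bounds(3)[OF K(2), of \<beta>] K by (cases "\<beta> < \<gamma>") (auto simp: K_def)
    then show ?thesis using True by (simp add: lpt_def rpt_def \<beta>_def \<gamma>_def)
  next
    case False
    then show ?thesis using left_bounds(1)[OF idx_K] by (auto simp: lpt_def rpt_def)
  qed
  show "A t = A (lpt k)" if "lpt k \<le> t" "t < rpt k" for k t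
  proof (cases "k \<in> idx")
    case True
    then show ?thesis using A_const[OF idx_K[OF True], of t] that by (simp add: lpt_def rpt_def)
  next
    case False
    then show ?thesis using that by (simp add: lpt_def rpt_def)
  qed
  show "\<exists>k. lpt k \<le> t \<and> t < rpt k" if t: "a \<le> t" "t < b" for t
  proof -
    \<comment> \<open>The step containing \<open>t\<close> is the one with right endpoint
      \<open>S t\<close>: no element of \<Lambda> lies strictly between \<open>t\<close> and
      \<open>S t\<close>, so \<open>left (S t) \<le> t\<close>.\<close>
    have K: "S t \<in> K" using succ_in[OF t(2)] t by (auto simp: K_def)
    have "left (S t) \<le> t"
      unfolding left_def
    proof (rule cSup_least)
      show "below \<Lambda> (S t) \<noteq> {}" using aL succ_in(2)[OF t(2)] t by (auto simp: below_def)
      show "x \<le> t" if "x \<in> below \<Lambda> (S t)" for x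
        using succ_in(3)[OF t(2), of x] that by (force simp: below_def)
    qed
    then show ?thesis using K succ_in(2)[OF t(2)]
      by (intro exI[of _ "to_nat_on K (S t)"]) (auto simp: lpt_def rpt_def idx_def countable_K)
  qed
qed

definition weight :: "real \<Rightarrow> real" where "weight \<alpha> = (S \<alpha> - \<alpha>) * norm (z \<alpha>)"

lemma weight_nonneg: "\<alpha> \<in> below \<Lambda> b \<Longrightarrow> 0 \<le> weight \<alpha>"
  using succ_in(2)[of \<alpha>] by (auto simp: weight_def below_def)

text \<open>Padding, gaps and empty steps have mass 0, so only right endpoints of the form
  \<open>S \<alpha>\<close> count, and \<alpha> is recovered as
  \<open>left (S \<alpha>)\<close>.\<close>

lemma summable_mass_iff: "summable mass \<longleftrightarrow> weight summable_on below \<Lambda> b"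
proof -
  define f where "f \<beta> = (\<beta> - left \<beta>) * norm (A (left \<beta>))" for \<beta>
  have "summable mass \<longleftrightarrow> mass summable_on UNIV"
    by (rule summable_on_UNIV_nonneg_real_iff[symmetric]) (rule mass_nonneg)
  also have "\<dots> \<longleftrightarrow> (\<lambda>k. f (from_nat_into K k)) summable_on idx"
    by (rule summable_on_cong_neutral) (auto simp: mass_def f_def lpt_def rpt_def)
  also have "\<dots> \<longleftrightarrow> (\<lambda>\<beta>. f (from_nat_into K (to_nat_on K \<beta>))) summable_on K"
    unfolding idx_def by (rule summable_on_reindex_bij_betw[symmetric]) (simp add: bij_betw_def inj_on_to_nat_on[OF countable_K])
  also have "\<dots> \<longleftrightarrow> f summable_on K"
    by (rule summable_on_cong) (simp add: countable_K)
  also have "\<dots> \<longleftrightarrow> f summable_on S ` below \<Lambda> b"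
  proof (rule summable_on_cong_neutral)
    show "f \<beta> = 0" if \<beta>: "\<beta> \<in> K - S ` below \<Lambda> b" for \<beta>
    \<comment> \<open>Either the step is a gap, where \<open>A\<close> vanishes, or \<beta> is the
      supremum of its predecessors and the step is empty.\<close>
    proof (cases "left \<beta> < \<beta>")
      case True
      then show ?thesis using A_gap[of \<beta> "left \<beta>"] \<beta> by (simp add: f_def)
    next
      case False
      then show ?thesis using left_bounds(2)[of \<beta>] \<beta> by (simp add: f_def)
    qed
  qed (use left_S in auto)
  also have "\<dots> \<longleftrightarrow> (\<lambda>\<alpha>. f (S \<alpha>)) summable_on below \<Lambda> b"
    using inj_on_inverseI[of "below \<Lambda> b" left S] left_S(1)
    by (intro summable_on_reindex_bij_betw[symmetric]) (auto simp: bij_betw_def)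
  also have "\<dots> \<longleftrightarrow> weight summable_on below \<Lambda> b"
  proof (rule summable_on_cong)
    fix \<alpha> assume \<alpha>: "\<alpha> \<in> below \<Lambda> b"
    then have "\<alpha> < S \<alpha>" using succ_in(2) by (auto simp: below_def)
    then show "f (S \<alpha>) = weight \<alpha>"
      using left_S(1)[OF \<alpha>] A_eq[OF \<alpha>, of \<alpha>] by (simp add: f_def weight_def)
  qed
  finally show ?thesis .
qed

section \<open>The three conditions on families in terms of \<open>weight\<close>\<close>

interpretation ix: wo_index "below \<Lambda> b"
proof
  fix X assume "X \<subseteq> below \<Lambda> b" "X \<noteq> {}"
  then show "\<exists>m\<in>X. \<forall>y\<in>X. m \<le> y"
    using well_ordered_set_least[OF wo, of X] by (metis below_def mem_Collect_eq subset_eq)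
next
  show "below \<Lambda> b \<noteq> {}" using aL ab by (auto simp: below_def)
  show "bdd_above (below \<Lambda> b)" by (rule bdd_aboveI[of _ b]) (auto simp: below_def)
qed

lemma wo_abs_summable_iff:
  "wo_abs_summable (below \<Lambda> b) (\<lambda>\<alpha>. (S \<alpha> - \<alpha>) *\<^sub>R z \<alpha>) \<longleftrightarrow> weight summable_on below \<Lambda> b"
proof -
  have "wo_abs_summable (below \<Lambda> b) (\<lambda>\<alpha>. (S \<alpha> - \<alpha>) *\<^sub>R z \<alpha>) \<longleftrightarrow>
      (\<lambda>\<alpha>. norm ((S \<alpha> - \<alpha>) *\<^sub>R z \<alpha>)) summable_on below \<Lambda> b"
    unfolding wo_abs_summable_def by (rule ix.wo_summable_iff_summable_on) simp
  also have "\<dots> \<longleftrightarrow> weight summable_on below \<Lambda> b"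
  proof (rule summable_on_cong)
    fix \<alpha> assume "\<alpha> \<in> below \<Lambda> b"
    then have "\<alpha> < S \<alpha>" using succ_in(2) by (simp add: below_def)
    then show "norm ((S \<alpha> - \<alpha>) *\<^sub>R z \<alpha>) = weight \<alpha>" by (simp add: weight_def)
  qed
  finally show ?thesis .
qed

lemma wo_multipliable_exp_iff:
  "wo_multipliable (below \<Lambda> b) (\<lambda>\<alpha>. exp ((S \<alpha> - \<alpha>) * norm (z \<alpha>))) \<longleftrightarrow> weight summable_on below \<Lambda> b"
  using ix.wo_multipliable_exp_iff[of weight "\<lambda>\<alpha>. exp ((S \<alpha> - \<alpha>) * norm (z \<alpha>))"]
    ix.wo_summable_iff_summable_on[of weight] weight_nonneg by (simp add: weight_def)

text \<open>Each factor \<open>1 + w\<close> is written as \<open>exp (ln (1 + w))\<close>, and the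
  families of \<open>ln (1 + w)\<close> and of \<open>w\<close> are summable together.\<close>

lemma wo_multipliable_one_plus_iff:
  "wo_multipliable (below \<Lambda> b) (\<lambda>\<alpha>. 1 + (S \<alpha> - \<alpha>) * norm (z \<alpha>)) \<longleftrightarrow> weight summable_on below \<Lambda> b"
proof -
  have "wo_multipliable (below \<Lambda> b) (\<lambda>\<alpha>. 1 + (S \<alpha> - \<alpha>) * norm (z \<alpha>)) \<longleftrightarrow>
      wo_summable (below \<Lambda> b) (\<lambda>\<alpha>. ln (1 + weight \<alpha>))"
  proof (rule ix.wo_multipliable_exp_iff)
    fix \<alpha> assume "\<alpha> \<in> below \<Lambda> b"
    then have "0 \<le> weight \<alpha>" by (rule weight_nonneg)
    then show "0 \<le> ln (1 + weight \<alpha>)" "1 + (S \<alpha> - \<alpha>) * norm (z \<alpha>) = exp (ln (1 + weight \<alpha>))"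
      by (simp_all add: weight_def add_pos_nonneg)
  qed
  also have "\<dots> \<longleftrightarrow> (\<lambda>\<alpha>. ln (1 + weight \<alpha>)) summable_on below \<Lambda> b"
    using weight_nonneg by (intro ix.wo_summable_iff_summable_on) auto
  also have "\<dots> \<longleftrightarrow> weight summable_on below \<Lambda> b"
    using weight_nonneg by (intro ix.summable_on_ln_one_plus_iff) auto
  finally show ?thesis .
qed

end

theorem theorem4p5:
  fixes a b :: real
    and \<Lambda> :: "real set"
    and z A :: "real \<Rightarrow> 'e::{real_normed_algebra_1, banach}"
  assumes "a < b"
    and "\<Lambda> \<subseteq> {a..b}" and "well_ordered_set \<Lambda>" and "a \<in> \<Lambda>" and "b \<in> \<Lambda>"
    and "is_step_function \<Lambda> a b z A"
  shows "(strongly_McShane_product_integrable a b A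
            \<longleftrightarrow> bochner_integrable (lebesgue_on {a..b}) A)
       \<and> (bochner_integrable (lebesgue_on {a..b}) A
            \<longleftrightarrow> wo_abs_summable (below \<Lambda> b) (\<lambda>\<alpha>. (succ_in \<Lambda> \<alpha> - \<alpha>) *\<^sub>R z \<alpha>))
       \<and> (wo_abs_summable (below \<Lambda> b) (\<lambda>\<alpha>. (succ_in \<Lambda> \<alpha> - \<alpha>) *\<^sub>R z \<alpha>)
            \<longleftrightarrow> wo_multipliable (below \<Lambda> b) (\<lambda>\<alpha>. exp ((succ_in \<Lambda> \<alpha> - \<alpha>) * norm (z \<alpha>))))
       \<and> (wo_multipliable (below \<Lambda> b) (\<lambda>\<alpha>. exp ((succ_in \<Lambda> \<alpha> - \<alpha>) * norm (z \<alpha>)))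
            \<longleftrightarrow> wo_multipliable (below \<Lambda> b) (\<lambda>\<alpha>. 1 + (succ_in \<Lambda> \<alpha> - \<alpha>) * norm (z \<alpha>)))"
proof -
  interpret step_function a b \<Lambda> z A by unfold_locales (use assms in auto)
  show ?thesis
    unfolding strongly_McShane_product_integrable_iff bochner_integrable_iff summable_mass_iff
      wo_abs_summable_iff wo_multipliable_exp_iff wo_multipliable_one_plus_iff by simp
qed

end
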